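(* Consider $A,B,u,v\in\mathbb{Q}$ with $AB\neq0$ such that $x^5+Ax+B$ has the quadratic factor $x^2+ux+v$. Then the polynomial $$\frac{x^{10}+Ax^2+B}{x^4+ux^2+v}$$ has reducibility type $(3,3)$ infinitely often, i.e. for infinitely many such $(A,B,u,v)$ that are pairwise inequivalent up to scaling; these are parametrized by the rational points of the elliptic curve $Y^2=X(X^2+12X-4)$, which has rank $1$ over $\mathbb{Q}$.
   Context: A monic polynomial in $\mathbb{Q}[x]$ has reducibility type $(n_1,\dots,n_k)$, $n_1\le\dots\le n_k$, if it factors as a product of $k$ irreducible polynomials in $\mathbb{Q}[x]$ of degrees $n_1,\dots,n_k$. Trinomials $x^{10}+Ax^2+B$ and $x^{10}+A\lambda^8x^2+B\lambda^{10}$, $\lambda\in\mathbb{Q}\setminus\{0\}$, are regarded as equivalent (scaling); correspondingly $(u,v)$ is replaced by $(\lambda^2u,\lambda^4v)$. *)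

theory Defs
  imports
    "HOL-Computational_Algebra.Computational_Algebra"
    "HOL-Algebra.FiniteProduct"
    "HOL-Library.Extended_Nat"
begin

definition has_reducibility_type :: "rat poly \<Rightarrow> nat list \<Rightarrow> bool" where
  "has_reducibility_type f ns \<longleftrightarrow>
     lead_coeff f = 1 \<and> sorted ns \<and>
     (\<exists>ps. (\<forall>p\<in>set ps. irreducible p) \<and> f = prod_list ps \<and> map degree ps = ns)"

definition trinomial5 :: "rat \<Rightarrow> rat \<Rightarrow> rat poly" where
  "trinomial5 A B = monom 1 5 + monom A 1 + monom B 0"

definition trinomial10 :: "rat \<Rightarrow> rat \<Rightarrow> rat poly" where
  "trinomial10 A B = monom 1 10 + monom A 2 + monom B 0"

type_synonym quadruple = "rat \<times> rat \<times> rat \<times> rat"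

definition quadratic_factor :: "quadruple \<Rightarrow> bool" where
  "quadratic_factor = (\<lambda>(A, B, u, v). [:v, u, 1:] dvd trinomial5 A B)"

text \<open>Whenever \<^const>\<open>quadratic_factor\<close> holds, this polynomial division is exact.\<close>
definition sextic :: "quadruple \<Rightarrow> rat poly" where
  "sextic = (\<lambda>(A, B, u, v). trinomial10 A B div [:v, 0, u, 0, 1:])"

definition type33_quadruples :: "quadruple set" where
  "type33_quadruples =
     {(A, B, u, v). A * B \<noteq> 0 \<and> quadratic_factor (A, B, u, v) \<and>
        has_reducibility_type (sextic (A, B, u, v)) [3, 3]}"

definition scaling_rel :: "(quadruple \<times> quadruple) set" where
  "scaling_rel =
     {((A, B, u, v), (A', B', u', v')) | A B u v A' B' u' v'.
        \<exists>l. l \<noteq> 0 \<and> A' = A * l ^ 8 \<and> B' = B * l ^ 10 \<and> u' = l ^ 2 * u \<and> v' = l ^ 4 * v}"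

datatype ec_point = Infinity | Affine rat rat

fun on_curve :: "rat \<Rightarrow> rat \<Rightarrow> rat \<Rightarrow> ec_point \<Rightarrow> bool" where
  "on_curve a b c Infinity = True"
| "on_curve a b c (Affine x y) = (y ^ 2 = x ^ 3 + a * x ^ 2 + b * x + c)"

text \<open>The discriminant of \<open>x\<^sup>3 + a x\<^sup>2 + b x + c\<close> is nonzero.\<close>
definition is_elliptic_curve :: "rat \<Rightarrow> rat \<Rightarrow> rat \<Rightarrow> bool" where
  "is_elliptic_curve a b c \<longleftrightarrow>
     a ^ 2 * b ^ 2 - 4 * b ^ 3 - 4 * a ^ 3 * c - 27 * c ^ 2 + 18 * a * b * c \<noteq> 0"

text \<open>Chord-and-tangent addition on \<open>y\<^sup>2 = x\<^sup>3 + a x\<^sup>2 + b x + c\<close>; \<open>l\<close> is the slope of the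
  line through the two points (the tangent if they coincide).\<close>
fun ec_add :: "rat \<Rightarrow> rat \<Rightarrow> ec_point \<Rightarrow> ec_point \<Rightarrow> ec_point" where
  "ec_add a b Infinity Q = Q"
| "ec_add a b P Infinity = P"
| "ec_add a b (Affine x1 y1) (Affine x2 y2) =
     (if x1 = x2 \<and> y1 = - y2 then Infinity
      else
        let l = (if x1 = x2 then (3 * x1 ^ 2 + 2 * a * x1 + b) / (2 * y1)
                 else (y2 - y1) / (x2 - x1));
            x3 = l ^ 2 - a - x1 - x2
        in Affine x3 (l * (x1 - x3) - y1))"

definition ec_group :: "rat \<Rightarrow> rat \<Rightarrow> rat \<Rightarrow> ec_point monoid" where
  "ec_group a b c =
     \<lparr>carrier = {P. on_curve a b c P}, monoid.mult = ec_add a b, one = Infinity\<rparr>"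

text \<open>Linear independence over the integers, with the group written multiplicatively.\<close>
definition int_independent :: "('a, 'b) monoid_scheme \<Rightarrow> 'a set \<Rightarrow> bool" where
  "int_independent G S \<longleftrightarrow>
     finite S \<and> S \<subseteq> carrier G \<and>
     (\<forall>n :: 'a \<Rightarrow> int. finprod G (\<lambda>s. s [^]\<^bsub>G\<^esub> n s) S = \<one>\<^bsub>G\<^esub> \<longrightarrow> (\<forall>s\<in>S. n s = 0))"

text \<open>The rank of an abelian group \<open>G\<close>, i.e. the dimension of its tensor product with the
  rational numbers.\<close>
definition group_rank :: "('a, 'b) monoid_scheme \<Rightarrow> enat" where
  "group_rank G = (SUP S \<in> {S. int_independent G S}. enat (card S))"

text \<open>Evaluation of a polynomial in two variables; the outer variable is \<open>Y\<close>.\<close>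
definition eval2 :: "rat poly poly \<Rightarrow> rat \<Rightarrow> rat \<Rightarrow> rat" where
  "eval2 F X Y = poly (poly F [:Y:]) X"

end

theory Submission
  imports Defs
begin

text \<open>
  If \<open>x\<^sup>2 + u x + v\<close> divides \<open>x\<^sup>5 + A x + B\<close>, then \<open>A\<close>, \<open>B\<close> are polynomials in \<open>u\<close>, \<open>v\<close> and the
  sextic is \<open>f = x\<^sup>6 - u x\<^sup>4 + (u\<^sup>2 - v) x\<^sup>2 + 2uv - u\<^sup>3\<close>. As \<open>f\<close> is even, an irreducible cubic factor
  \<open>p = x\<^sup>3 + a x\<^sup>2 + b x + c\<close> forces \<open>f = - p(x) p(-x)\<close>; comparing coefficients and setting \<open>X = 2a\<^sup>2/u\<close>,
  \<open>Y = X\<^sup>2(c + 2au)/a\<^sup>3\<close> gives the curve \<open>Y\<^sup>2 = X(X\<^sup>2 + 12X - 4)\<close>, and unique factorization makes \<open>(X, Y)\<close>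
  an invariant of the scaling class. For \<open>X \<equiv> 1\<close> modulo 3 the cubic has no root modulo 3, and the points
  \<open>(1,3) + 2\<^sup>k(1,3)\<close>, \<open>k \<ge> 1\<close>, have this property.

  The group law is transported from a twisted Edwards curve, where associativity is a polynomial identity.
  Its addition law is complete on the image of the rational points because 160 is not a rational square.
  The point \<open>(1,3)\<close> has infinite order since the 2-adic valuation of \<open>x\<close> drops with each
  doubling. Conversely, 2-descent shows that every rational point is \<open>2Q\<close> up to a combination of
  \<open>(0,0)\<close> and \<open>(1,3)\<close>; iterating inside a finite set of points of bounded height, the sequence of
  points \<open>Q\<close> repeats, which makes every point commensurable with \<open>(1,3)\<close>.
\<close>

section \<open>The group law\<close>

definition ed_add :: "'a::field \<Rightarrow> 'a \<Rightarrow> 'a \<times> 'a \<Rightarrow> 'a \<times> 'a \<Rightarrow> 'a \<times> 'a" where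
  "ed_add a d = (\<lambda>(u1, v1) (u2, v2).
     ((u1 * v2 + u2 * v1) / (1 + d * u1 * v1 * u2 * v2),
      (v1 * v2 - a * u1 * u2) / (1 - d * u1 * v1 * u2 * v2)))"

definition ed_curve :: "'a::field \<Rightarrow> 'a \<Rightarrow> 'a \<times> 'a \<Rightarrow> bool" where
  "ed_curve a d = (\<lambda>(u, v). a * u ^ 2 + v ^ 2 = 1 + d * u ^ 2 * v ^ 2)"

definition ed_defined :: "'a::field \<Rightarrow> 'a \<times> 'a \<Rightarrow> 'a \<times> 'a \<Rightarrow> bool" where
  "ed_defined d = (\<lambda>(u1, v1) (u2, v2).
     1 + d * u1 * v1 * u2 * v2 \<noteq> 0 \<and> 1 - d * u1 * v1 * u2 * v2 \<noteq> 0)"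

text \<open>These are the first coordinates of the two bracketings of a triple sum, cross-multiplied
  after the inner denominators are cleared. What remains follows polynomially from the three curve
  equations, so it holds over every field.\<close>

lemma ed_assoc_fst:
  fixes a d u1 v1 u2 v2 u3 v3 :: "'a::field"
  assumes "a*u1^2+v1^2 = 1+d*u1^2*v1^2" "a*u2^2+v2^2 = 1+d*u2^2*v2^2" "a*u3^2+v3^2 = 1+d*u3^2*v3^2"
  shows "((u1*v2+u2*v1)*v3*(1-d*u1*v1*u2*v2) + u3*(v1*v2-a*u1*u2)*(1+d*u1*v1*u2*v2)) *
     ((1+d*u2*v2*u3*v3)*(1-d*u2*v2*u3*v3) + d*u1*v1*(u2*v3+u3*v2)*(v2*v3-a*u2*u3)) =
    (u1*(v2*v3-a*u2*u3)*(1+d*u2*v2*u3*v3) + (u2*v3+u3*v2)*v1*(1-d*u2*v2*u3*v3)) *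
     ((1+d*u1*v1*u2*v2)*(1-d*u1*v1*u2*v2) + d*(u1*v2+u2*v1)*(v1*v2-a*u1*u2)*u3*v3)"
  using assms by algebra

lemma ed_assoc_snd:
  fixes a d u1 v1 u2 v2 u3 v3 :: "'a::field"
  assumes "a*u1^2+v1^2 = 1+d*u1^2*v1^2" "a*u2^2+v2^2 = 1+d*u2^2*v2^2" "a*u3^2+v3^2 = 1+d*u3^2*v3^2"
  shows "((v1*v2-a*u1*u2)*v3*(1+d*u1*v1*u2*v2) - a*(u1*v2+u2*v1)*u3*(1-d*u1*v1*u2*v2)) *
     ((1+d*u2*v2*u3*v3)*(1-d*u2*v2*u3*v3) - d*u1*v1*(u2*v3+u3*v2)*(v2*v3-a*u2*u3)) =
    (v1*(v2*v3-a*u2*u3)*(1+d*u2*v2*u3*v3) - a*u1*(u2*v3+u3*v2)*(1-d*u2*v2*u3*v3)) *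
     ((1+d*u1*v1*u2*v2)*(1-d*u1*v1*u2*v2) - d*(u1*v2+u2*v1)*(v1*v2-a*u1*u2)*u3*v3)"
  using assms by algebra

text \<open>Here \<open>P\<close>, \<open>M\<close> are the denominators and \<open>N\<close>,
  \<open>L\<close> the numerators of the inner sum \<open>p + q\<close>; the primed letters belong
  to \<open>q + r\<close>. Since division by zero yields 0, the fractions can be compared only where
  all four additions are defined.\<close>

lemma ed_add_assoc:
  assumes c: "ed_curve a d p" "ed_curve a d q" "ed_curve a d r"
    and "ed_defined d p q" "ed_defined d q r"
    and "ed_defined d (ed_add a d p q) r" "ed_defined d p (ed_add a d q r)"
  shows "ed_add a d (ed_add a d p q) r = ed_add a d p (ed_add a d q r)"
proof -
  obtain u1 v1 u2 v2 u3 v3 where pqr: "p = (u1, v1)" "q = (u2, v2)" "r = (u3, v3)"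
    by (metis surj_pair)
  define P M N L where "P = 1+d*u1*v1*u2*v2" and "M = 1-d*u1*v1*u2*v2"
    and "N = u1*v2+u2*v1" and "L = v1*v2-a*u1*u2"
  define P' M' N' L' where "P' = 1+d*u2*v2*u3*v3" and "M' = 1-d*u2*v2*u3*v3"
    and "N' = u2*v3+u3*v2" and "L' = v2*v3-a*u2*u3"
  have nz: "P \<noteq> 0" "M \<noteq> 0" "P' \<noteq> 0" "M' \<noteq> 0"
    using assms(4,5) by (simp_all add: pqr ed_defined_def P_def M_def P'_def M'_def)
  have l: "ed_add a d p q = (N/P, L/M)" and r: "ed_add a d q r = (N'/P', L'/M')"
    by (simp_all add: pqr ed_add_def P_def M_def N_def L_def P'_def M'_def N'_def L'_def)
  have nzl: "1 + d*(N/P)*(L/M)*u3*v3 \<noteq> 0" "1 - d*(N/P)*(L/M)*u3*v3 \<noteq> 0"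
    using assms(6)[unfolded l, unfolded pqr ed_defined_def prod.case] by blast+
  have nzr: "1 + d*u1*v1*(N'/P')*(L'/M') \<noteq> 0" "1 - d*u1*v1*(N'/P')*(L'/M') \<noteq> 0"
    using assms(7)[unfolded r, unfolded pqr ed_defined_def prod.case] by blast+
  have dl: "1 + d*(N/P)*(L/M)*u3*v3 = (P*M + d*N*L*u3*v3) / (P*M)"
      "1 - d*(N/P)*(L/M)*u3*v3 = (P*M - d*N*L*u3*v3) / (P*M)"
    using nz by (simp_all add: field_simps)
  have dr: "1 + d*u1*v1*(N'/P')*(L'/M') = (P'*M' + d*u1*v1*N'*L') / (P'*M')"
      "1 - d*u1*v1*(N'/P')*(L'/M') = (P'*M' - d*u1*v1*N'*L') / (P'*M')"
    using nz by (simp_all add: field_simps)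
  have nzl': "P*M + d*N*L*u3*v3 \<noteq> 0" "P*M - d*N*L*u3*v3 \<noteq> 0" using nzl unfolding dl by auto
  have nzr': "P'*M' + d*u1*v1*N'*L' \<noteq> 0" "P'*M' - d*u1*v1*N'*L' \<noteq> 0" using nzr unfolding dr by auto
  have e: "a*u1^2+v1^2 = 1+d*u1^2*v1^2" "a*u2^2+v2^2 = 1+d*u2^2*v2^2" "a*u3^2+v3^2 = 1+d*u3^2*v3^2"
    using c by (simp_all add: pqr ed_curve_def)
  have numl: "N/P*v3 + u3*(L/M) = (N*v3*M + u3*L*P) / (P*M)"
     "L/M*v3 - a*(N/P)*u3 = (L*v3*P - a*N*u3*M) / (P*M)"
    using nz by (simp_all add: field_simps)
  have numr: "u1*(L'/M') + N'/P'*v1 = (u1*L'*P' + N'*v1*M') / (P'*M')"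
     "v1*(L'/M') - a*u1*(N'/P') = (v1*L'*P' - a*u1*N'*M') / (P'*M')"
    using nz by (simp_all add: field_simps)
  have "ed_add a d (ed_add a d p q) r =
    ((N*v3*M + u3*L*P) / (P*M + d*N*L*u3*v3), (L*v3*P - a*N*u3*M) / (P*M - d*N*L*u3*v3))"
    unfolding l unfolding pqr ed_add_def prod.case dl numl using nz by simp
  moreover have "ed_add a d p (ed_add a d q r) =
    ((u1*L'*P' + N'*v1*M') / (P'*M' + d*u1*v1*N'*L'), (v1*L'*P' - a*u1*N'*M') / (P'*M' - d*u1*v1*N'*L'))"
    unfolding r unfolding pqr ed_add_def prod.case dr numr using nz by simp
  moreover have "(N*v3*M + u3*L*P) * (P'*M' + d*u1*v1*N'*L') = (u1*L'*P' + N'*v1*M') * (P*M + d*N*L*u3*v3)"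
    using ed_assoc_fst[OF e] unfolding P_def M_def N_def L_def P'_def M'_def N'_def L'_def .
  moreover have "(L*v3*P - a*N*u3*M) * (P'*M' - d*u1*v1*N'*L') = (v1*L'*P' - a*u1*N'*M') * (P*M - d*N*L*u3*v3)"
    using ed_assoc_snd[OF e] unfolding P_def M_def N_def L_def P'_def M'_def N'_def L'_def .
  ultimately show ?thesis using nzl' nzr' by (simp add: frac_eq_eq)
qed

section \<open>Chords and tangents on the curve\<close>

abbreviation on_E :: "ec_point \<Rightarrow> bool" where "on_E \<equiv> on_curve 12 (-4) 0"
abbreviation add_E :: "ec_point \<Rightarrow> ec_point \<Rightarrow> ec_point" (infixl \<open>\<uplus>\<close> 65) where
  "P \<uplus> Q \<equiv> ec_add 12 (-4) P Q"

text \<open>Chords and tangents alike are lines \<open>y = l x + k\<close> meeting the curve in \<open>x1\<close>, \<open>x2\<close>, \<open>x3\<close>; only the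
  symmetric functions of these are used afterwards.\<close>

lemma add_E_line:
  assumes "on_E (Affine x1 y1)" "on_E (Affine x2 y2)" "\<not> (x1 = x2 \<and> y1 = - y2)"
  obtains l k x3 where "Affine x1 y1 \<uplus> Affine x2 y2 = Affine x3 (-(l*x3+k))"
    "y1 = l*x1+k" "y2 = l*x2+k"
    "x1+x2+x3 = l^2-12" "x1*x2+x1*x3+x2*x3 = -4-2*l*k" "x1*x2*x3 = k^2"
proof -
  define l where "l = (if x1 = x2 then (3 * x1 ^ 2 + 24 * x1 - 4) / (2 * y1) else (y2 - y1) / (x2 - x1))"
  define k where "k = y1 - l*x1"
  define x3 where "x3 = l^2-12-x1-x2"
  have f: "y1^2 = x1^3+12*x1^2-4*x1" "y2^2 = x2^3+12*x2^2-4*x2" using assms by simp_all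
  have 1: "Affine x1 y1 \<uplus> Affine x2 y2 = Affine x3 (-(l*x3+k))"
    using assms(3) by (auto simp: Let_def l_def k_def x3_def algebra_simps)
  have 2: "y1 = l*x1+k" by (simp add: k_def)
  have s1: "x1+x2+x3 = l^2-12" by (simp add: x3_def)
  have 34: "y2 = l*x2+k \<and> x1*x2+x1*x3+x2*x3 = -4-2*l*k"
  proof (cases "x1 = x2")
    case True
    then have "y1^2 = y2^2" using f by simp
    then have y: "y2 = y1" using True assms(3) by (metis minus_equation_iff power2_eq_iff)
    have "y1 \<noteq> 0" using y True assms(3) by auto
    then have "2*l*y1 = 3*x1^2+24*x1-4" using True by (simp add: l_def)
    then show ?thesis using 2 s1 True y by algebra
  next
    case False
    then have "l*(x2-x1) = y2-y1" by (simp add: l_def)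
    then have y2: "y2 = l*x2+k" unfolding k_def by algebra
    \<comment> \<open>Both abscissas are roots of the monic cubic obtained by inserting
      \<open>y = l x + k\<close> into the curve; the difference of the two equations has the factor
      \<open>x1 - x2\<close>.\<close>
    have "(x1-x2)*(x1*x2+x1*x3+x2*x3) = (x1-x2)*(-4-2*l*k)"
      using f 2 y2 s1 by algebra
    then show ?thesis using False y2 by simp
  qed
  then have "x1*x2*x3 = k^2" using f(1) 2 s1 by algebra
  then show thesis using that 1 2 34 s1 by blast
qed

lemma on_E_add:
  assumes "on_E P" "on_E Q" shows "on_E (P \<uplus> Q)"
proof (cases P)
  case Infinity then show ?thesis using assms by simp
next
  case P: (Affine x1 y1)
  show ?thesis
  proof (cases Q)
    case Infinity then show ?thesis using assms P by simp
  next
    case Q: (Affine x2 y2)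
    show ?thesis
    proof (cases "x1 = x2 \<and> y1 = - y2")
      case True then show ?thesis using P Q by simp
    next
      case False
      from add_E_line[OF assms[unfolded P Q] False] obtain l k x3 where
       *: "Affine x1 y1 \<uplus> Affine x2 y2 = Affine x3 (-(l*x3+k))"
       "x1+x2+x3 = l^2-12" "x1*x2+x1*x3+x2*x3 = -4-2*l*k" "x1*x2*x3 = k^2" by metis
      \<comment> \<open>By its symmetric functions, \<open>x3\<close> is the third root of the cubic
        that cuts out the line on the curve.\<close>
      have "(-(l*x3+k))^2 = x3^3+12*x3^2-4*x3" using *(2-4) by algebra
      then show ?thesis using P Q *(1) by (simp del: ec_add.simps minus_add_distrib)
    qed
  qed
qed

section \<open>The embedding into a complex Edwards curve, and the role of 160\<close>

lemma int_sqrt_rat: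
  fixes r :: rat
  assumes "r ^ 2 = of_int n"
  obtains m where "r = of_int m" "m ^ 2 = n"
proof -
  obtain p q where pq: "quotient_of r = (p, q)" by fastforce
  then have r: "r = of_int p / of_int q" and q: "q > 0" and co: "coprime p q"
    by (simp_all add: quotient_of_div quotient_of_denom_pos quotient_of_coprime)
  have "(of_int p :: rat)^2 = of_int n * (of_int q)^2"
    using assms q by (simp add: r power_divide field_simps)
  then have "of_int (p^2) = (of_int (n*q^2) :: rat)" by simp
  then have pn: "p^2 = n*q^2" by (simp only: of_int_eq_iff)
  then have "q dvd p^2" by (simp add: power2_eq_square)
  with co have "is_unit q" by (meson coprime_common_divisor coprime_power_left_iff dvd_refl zero_less_numeral)
  with q have "q = 1" by simp
  then show thesis using that[of p] r pn by simp
qed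

text \<open>The number 160 enters twice: it is the discriminant of \<open>x^2 + 12 x - 4\<close>, so
  that (0,0) is the only rational point of order two, and it is the squared absolute value of the
  Edwards coefficient 12 - 4i.\<close>

lemma not_square_160: "(r::rat)^2 \<noteq> 160"
proof
  assume "r^2 = 160"
  then obtain m :: int where m: "m^2 = 160" using int_sqrt_rat[of r 160] by auto
  then have "\<bar>m\<bar>^2 = 160" by simp
  moreover have "\<bar>m\<bar> \<le> 12 \<or> \<bar>m\<bar> \<ge> 13" by linarith
  moreover have "\<bar>m\<bar> \<le> 12 \<Longrightarrow> \<bar>m\<bar>^2 \<le> 12^2" by (rule power_mono) auto
  moreover have "\<bar>m\<bar> \<ge> 13 \<Longrightarrow> \<bar>m\<bar>^2 \<ge> 13^2" by (rule power_mono) auto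
  ultimately show False by auto
qed

lemma on_E_y_eq_0: "on_E (Affine x y) \<Longrightarrow> y = 0 \<longleftrightarrow> x = 0"
proof -
  assume "on_E (Affine x y)"
  then have f: "y^2 = x*(x^2+12*x-4)" by (simp add: algebra_simps power2_eq_square power3_eq_cube)
  have "x^2+12*x-4 \<noteq> 0"
  proof
    assume "x^2+12*x-4 = 0"
    then have "(2*x+12)^2 = 160" by algebra
    then show False using not_square_160 by blast
  qed
  then show ?thesis using f by auto
qed

text \<open>The point at infinity goes to the neutral element \<open>(0, 1)\<close> and, since \<open>0 / 0 = 0\<close>, \<open>(0, 0)\<close> goes
  to \<open>(0, -1)\<close>; there are no other points with \<open>y = 0\<close>.\<close>

fun psi :: "ec_point \<Rightarrow> complex \<times> complex" where
  "psi Infinity = (0, 1)"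
| "psi (Affine x y) = (of_rat x / of_rat y, (of_rat x - 2*\<i>) / (of_rat x + 2*\<i>))"

text \<open>The coefficients are 12 + 2c and 12 - 2c for c = 2i. A point with abscissa c doubles to
  (0,0), so it has order 4, as the Edwards form requires; no such point is rational, hence the
  passage to complex numbers.\<close>

abbreviation ed_E :: "complex \<times> complex \<Rightarrow> complex \<times> complex \<Rightarrow> complex \<times> complex" where
  "ed_E \<equiv> ed_add (12+4*\<i>) (12-4*\<i>)"

lemma of_rat_Im [simp]: "Im (of_rat r) = 0"
  by (cases r) (simp add: of_rat_rat)

lemma norm_of_rat_complex: "norm (of_rat r :: complex) = \<bar>of_rat r\<bar>"
  by (cases r) (simp add: of_rat_rat norm_divide)

lemma of_rat_plus_i_nonzero [simp]: "of_rat x + 2*\<i> \<noteq> (0::complex)" "of_rat x \<noteq> 2*\<i>"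
  by (auto simp: complex_eq_iff)

lemma psi_curve:
  assumes "on_E P" shows "ed_curve (12+4*\<i>) (12-4*\<i>) (psi P)"
proof (cases P)
  case (Affine x y)
  show ?thesis
  proof (cases "x = 0")
    case True then show ?thesis by (simp add: Affine ed_curve_def)
  next
    case False
    define X Y :: complex where "X = of_rat x" and "Y = of_rat y"
    have "y \<noteq> 0" using on_E_y_eq_0 assms Affine False by blast
    then have nz: "Y \<noteq> 0" "X + 2*\<i> \<noteq> 0" by (simp_all add: X_def Y_def)
    have "y^2 = x^3+12*x^2-4*x" using assms Affine by simp
    then have "Y^2 = X^3+12*X^2-4*X"
      unfolding X_def Y_def by (simp flip: of_rat_power add: of_rat_add of_rat_mult of_rat_diff)
    moreover have "\<i>^2 = -1" by simp
    moreover define U V where "U = X / Y" and "V = (X - 2*\<i>) / (X + 2*\<i>)"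
    then have "U * Y = X" "V * (X + 2*\<i>) = X - 2*\<i>" using nz by simp_all
    ultimately have "(Y * (X + 2*\<i>))^2 * ((12+4*\<i>)*U^2 + V^2) = (Y * (X + 2*\<i>))^2 * (1 + (12-4*\<i>)*U^2*V^2)"
      by algebra
    then have "(12+4*\<i>)*U^2 + V^2 = 1 + (12-4*\<i>)*U^2*V^2" using nz by simp
    then show ?thesis by (simp add: ed_curve_def Affine X_def Y_def U_def V_def)
  qed
qed (simp add: ed_curve_def)

text \<open>For rational \<open>x\<close> the numerator and the denominator of the second coordinate
  are complex conjugates.\<close>

lemma norm_psi: "norm (snd (psi P)) = 1"
proof (cases P)
  case (Affine x y)
  have "norm (of_rat x - 2*\<i>) = norm (of_rat x + 2*\<i>)" by (simp add: cmod_def)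
  moreover have "norm (of_rat x + 2*\<i>) \<noteq> 0" by simp
  ultimately show ?thesis using Affine by (simp add: norm_divide del: norm_eq_zero)
qed simp

text \<open>First coordinates are rational and second coordinates have norm 1, so the squared norm
  of the product in the denominators is 160 times a rational square. This is never 1, so neither
  denominator vanishes.\<close>

lemma psi_defined: "ed_defined (12-4*\<i>) (psi P) (psi Q)"
proof -
  have fst: "\<exists>r. fst (psi R) = of_rat r" for R
    by (cases R) (auto simp: of_rat_divide[symmetric] intro: exI[of _ 0])
  obtain r s where rs: "fst (psi P) = of_rat r" "fst (psi Q) = of_rat s" using fst by metis
  define z where "z = (12-4*\<i>) * fst (psi P) * snd (psi P) * fst (psi Q) * snd (psi Q)"
  have "norm (12-4*\<i>) ^ 2 = 160" by (simp add: cmod_def)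
  then have "norm z ^ 2 = 160 * of_rat (r*s) ^ 2"
    by (simp add: z_def norm_mult norm_psi power_mult_distrib rs of_rat_mult)
       (simp add: norm_of_rat_complex power_mult_distrib flip: of_rat_power)
  moreover have "160 * (of_rat (r*s) :: real) ^ 2 \<noteq> 1"
  proof
    assume "160 * (of_rat (r*s) :: real) ^ 2 = 1"
    then have "of_rat (160 * (r*s)^2) = (of_rat 1 :: real)" by (simp add: of_rat_mult of_rat_power)
    then have *: "160 * (r*s)^2 = 1" by (simp only: of_rat_eq_iff)
    then have "(160 * (r*s))^2 = 160" by algebra
    then show False using not_square_160 by blast
  qed
  ultimately have "norm z \<noteq> 1" by auto
  then have "1 + z \<noteq> 0" "1 - z \<noteq> 0" by (metis add_eq_0_iff norm_minus_cancel norm_one) (use \<open>norm z \<noteq> 1\<close> in auto)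
  then show ?thesis by (cases "psi P"; cases "psi Q") (simp add: ed_defined_def z_def)
qed

text \<open>The second coordinate is a Moebius function of \<open>x\<close> that omits the value 1,
  hence determines \<open>x\<close>; the first coordinate then determines \<open>y\<close>, with
  \<open>x = 0\<close> treated separately.\<close>

lemma psi_inj: assumes "on_E P" "on_E Q" "psi P = psi Q" shows "P = Q"
proof -
  have neq: "(of_rat x - 2*\<i>) / (of_rat x + 2*\<i>) \<noteq> (1::complex)" for x
  proof
    assume "(of_rat x - 2*\<i>) / (of_rat x + 2*\<i>) = (1::complex)"
    then have "of_rat x - 2*\<i> = (of_rat x + 2*\<i> :: complex)" by (simp add: divide_eq_1_iff)
    then show False by (simp add: complex_eq_iff)
  qed
  show ?thesis
  proof (cases P)
    case Infinity
    then show ?thesis using assms neq by (cases Q) auto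
  next
    case P: (Affine x y)
    then obtain x' y' where Q: "Q = Affine x' y'" using assms(3) neq by (cases Q) auto
    define X X' :: complex where "X = of_rat x" and "X' = of_rat x'"
    have "(X - 2*\<i>) / (X + 2*\<i>) = (X' - 2*\<i>) / (X' + 2*\<i>)"
      using assms(3) P Q by (simp add: X_def X'_def)
    then have "(X - 2*\<i>) * (X' + 2*\<i>) = (X' - 2*\<i>) * (X + 2*\<i>)"
      by (simp add: X_def X'_def frac_eq_eq)
    then have "4*\<i>*X = 4*\<i>*X'" by algebra
    then have x: "x = x'" by (simp add: X_def X'_def)
    have "of_rat x / of_rat y = (of_rat x / of_rat y' :: complex)" using assms(3) P Q x by simp
    moreover have "y = 0 \<longleftrightarrow> x = 0" "y' = 0 \<longleftrightarrow> x = 0" using on_E_y_eq_0 assms P Q x by blast+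
    ultimately show ?thesis using P Q x by (cases "x = 0") auto
  qed
qed

text \<open>With \<open>j\<close> for the imaginary unit, this is the first Edwards coordinate of
  the sum, multiplied by all denominators, for points on a common line; \<open>y3\<close> already
  carries the reflection. \<open>collinear_v\<close> is the second coordinate.\<close>

lemma collinear_u:
  fixes j :: "'a::field"
  assumes "j^2 = -1" "x1+x2+x3 = l^2-12" "x1*x2+x1*x3+x2*x3 = -4-2*l*k" "x1*x2*x3 = k^2"
    "y1 = l*x1+k" "y2 = l*x2+k" "y3 = -(l*x3+k)"
  shows "x3*(y1*y2*(x1+2*j)*(x2+2*j) + (12-4*j)*x1*(x1-2*j)*x2*(x2-2*j)) =
    y3*(x1*y2*(x2-2*j)*(x1+2*j) + x2*y1*(x1-2*j)*(x2+2*j))"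
  using assms by algebra

lemma collinear_v:
  fixes j :: "'a::field"
  assumes "j^2 = -1" "x1+x2+x3 = l^2-12" "x1*x2+x1*x3+x2*x3 = -4-2*l*k" "x1*x2*x3 = k^2"
    "y1 = l*x1+k" "y2 = l*x2+k" "y3 = -(l*x3+k)"
  shows "(x3-2*j)*(y1*y2*(x1+2*j)*(x2+2*j) - (12-4*j)*x1*(x1-2*j)*x2*(x2-2*j)) =
    (x3+2*j)*(y1*y2*(x1-2*j)*(x2-2*j) - (12+4*j)*x1*x2*(x1+2*j)*(x2+2*j))"
  using assms by algebra

lemmas of_rat_dist = of_rat_add of_rat_mult of_rat_diff of_rat_minus of_rat_power

lemma ed_addI:
  assumes "ed_defined d (u1, v1) (u2, v2)"
    "u3 * (1 + d*u1*v1*u2*v2) = u1*v2+u2*v1" "v3 * (1 - d*u1*v1*u2*v2) = v1*v2-a*u1*u2"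
  shows "ed_add a d (u1, v1) (u2, v2) = (u3, v3)"
  using assms by (simp add: ed_add_def ed_defined_def divide_eq_eq)

text \<open>Translation by (0,0) corresponds to Edwards addition of (0,-1), which negates both
  coordinates. This serves the cases of \<open>psi_add\<close> in which an abscissa is zero.\<close>

lemma psi_add_T:
  assumes "on_E (Affine x y)" "x \<noteq> 0"
  shows "psi (Affine (-4/x) (4*y/x^2)) = (- fst (psi (Affine x y)), - snd (psi (Affine x y)))"
proof -
  have y: "y \<noteq> 0" using on_E_y_eq_0 assms by blast
  define X Y :: complex where "X = of_rat x" and "Y = of_rat y"
  have nz: "X \<noteq> 0" "Y \<noteq> 0" "X + 2*\<i> \<noteq> 0" "X - 2*\<i> \<noteq> 0" using assms(2) y by (simp_all add: X_def Y_def)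
  have "(-4/X - 2*\<i>) = -2*\<i>*(X-2*\<i>)/X" "(-4/X + 2*\<i>) = 2*\<i>*(X+2*\<i>)/X"
    using nz by (simp_all add: field_simps)
  moreover have quot: "(-2*\<i>*W/X) / (2*\<i>*Z/X) = - (W/Z)" if "Z \<noteq> 0" for W Z
    using that nz(1) by (simp add: field_simps)
  ultimately have "(-4/X - 2*\<i>) / (-4/X + 2*\<i>) = - ((X - 2*\<i>) / (X + 2*\<i>))"
    using nz quot[of "X + 2*\<i>" "X - 2*\<i>"] by (simp only:)
  moreover have "(-4/X) / (4*Y/X^2) = - (X / Y)" using nz by (simp add: power2_eq_square)
  ultimately show ?thesis by (simp add: of_rat_divide of_rat_dist X_def Y_def)
qed

lemma psi_add:
  assumes "on_E P" "on_E Q" shows "psi (P \<uplus> Q) = ed_E (psi P) (psi Q)"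
proof (cases P)
  case Infinity then show ?thesis by (cases "psi Q") (simp add: ed_add_def)
next
  case P: (Affine x1 y1)
  show ?thesis
  proof (cases Q)
    case Infinity then show ?thesis using P by (cases "psi P") (simp add: ed_add_def)
  next
    case Q: (Affine x2 y2)
    obtain u1 v1 u2 v2 where uv: "psi P = (u1, v1)" "psi Q = (u2, v2)" by (metis surj_pair)
    have df: "ed_defined (12-4*\<i>) (u1, v1) (u2, v2)" using psi_defined uv by metis
    have c2: "(12+4*\<i>) * u2^2 + v2^2 = 1 + (12-4*\<i>) * u2^2 * v2^2"
      using psi_curve[OF assms(2)] uv by (simp add: ed_curve_def)
    show ?thesis
    proof (cases "x1 = x2 \<and> y1 = - y2")
      case True
      \<comment> \<open>Inverse points have images of the form (u,v) and (-u,v), whose Edwards sum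
        is (0,1) by the curve equation.\<close>
      then have "u1 = - u2" "v1 = v2" using uv P Q by (auto simp: of_rat_minus)
      moreover from this have "ed_E (u1, v1) (u2, v2) = (0, 1)"
        using c2 by (intro ed_addI df) (simp_all, algebra)
      ultimately show ?thesis using True P Q uv by simp
    next
      case False
      from add_E_line[OF assms[unfolded P Q] False] obtain l k x3 where
       sum: "Affine x1 y1 \<uplus> Affine x2 y2 = Affine x3 (-(l*x3+k))"
       and y: "y1 = l*x1+k" "y2 = l*x2+k"
       and s: "x1+x2+x3 = l^2-12" "x1*x2+x1*x3+x2*x3 = -4-2*l*k" "x1*x2*x3 = k^2" by metis
      have on3: "on_E (Affine x3 (-(l*x3+k)))" using on_E_add assms P Q sum by metis
      have y0: "y1 = 0 \<longleftrightarrow> x1 = 0" "y2 = 0 \<longleftrightarrow> x2 = 0" "l*x3+k = 0 \<longleftrightarrow> x3 = 0"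
        using on_E_y_eq_0 assms P Q on_E_y_eq_0[OF on3] by auto
      \<comment> \<open>A vanishing abscissa means that the point is (0,0), where \<open>psi\<close>
        rests on 0 / 0 = 0 and the collinearity identities cannot be divided by the ordinate. Only
        the last case is generic.\<close>
      consider "x1 = 0" | "x1 \<noteq> 0" "x2 = 0" | "x1 \<noteq> 0" "x2 \<noteq> 0" "x3 = 0" | "x1 \<noteq> 0" "x2 \<noteq> 0" "x3 \<noteq> 0"
        by blast
      then show ?thesis
      proof cases
        case 1
        then have k: "k = 0" using y y0 by simp
        have x2: "x2 \<noteq> 0" using 1 False y0 by auto
        have x3: "x3 = -4/x2" using s(2) 1 k x2 by (simp add: field_simps)
        have "-(l*x3+k) = 4*y2/x2^2" using x2 by (simp add: x3 y k power2_eq_square)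
        then have "psi (P \<uplus> Q) = (-u2, -v2)"
          using sum psi_add_T[OF assms(2)[unfolded Q] x2] uv Q P x3 by (simp del: ec_add.simps)
        moreover have "u1 = 0" "v1 = -1" using uv(1) P 1 by auto
        ultimately show ?thesis by (simp add: uv ed_add_def)
      next
        case 2
        then have k: "k = 0" using y y0 by simp
        have x3: "x3 = -4/x1" using s(2) 2 k by (simp add: field_simps)
        have "-(l*x3+k) = 4*y1/x1^2" using 2 by (simp add: x3 y k power2_eq_square)
        then have "psi (P \<uplus> Q) = (-u1, -v1)"
          using sum psi_add_T[OF assms(1)[unfolded P]] 2 uv Q P x3 by (simp del: ec_add.simps)
        moreover have "u2 = 0" "v2 = -1" using uv(2) Q 2 by auto
        ultimately show ?thesis by (simp add: uv ed_add_def)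
      next
        case 3
        then have k: "k = 0" using y0 by simp
        have x1: "x1 = -4/x2" using s(2) 3 k by (simp add: field_simps)
        have "y1 = -(4*y2/x2^2)" using 3 by (simp add: x1 y k power2_eq_square)
        then have "u1 = u2" "v1 = -v2"
          using psi_add_T[OF assms(2)[unfolded Q]] 3 uv Q P x1 by (auto simp: of_rat_minus)
        \<comment> \<open>Here the sum is (0,0), whose image is (0,-1); the second coordinate
          reduces to the curve equation for the second point.\<close>
        moreover have "ed_E (u1, v1) (u2, v2) = (0, -1)"
        proof (intro ed_addI df)
          show "0 * (1 + (12-4*\<i>)*u1*v1*u2*v2) = u1*v2+u2*v1"
            using \<open>u1 = u2\<close> \<open>v1 = -v2\<close> by simp
          have "v1*v2-(12+4*\<i>)*u1*u2 = -((12+4*\<i>)*u2^2 + v2^2)"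
            using \<open>u1 = u2\<close> \<open>v1 = -v2\<close> by (simp add: power2_eq_square)
          then show "-1 * (1 - (12-4*\<i>)*u1*v1*u2*v2) = v1*v2-(12+4*\<i>)*u1*u2"
            unfolding c2 using \<open>u1 = u2\<close> \<open>v1 = -v2\<close> by (simp add: power2_eq_square)
        qed
        ultimately show ?thesis using sum 3 k P Q uv by (simp del: ec_add.simps)
      next
        case 4
        define X1 X2 X3 Y1 Y2 Y3 L K :: complex where "X1 = of_rat x1" and "X2 = of_rat x2"
          and "X3 = of_rat x3" and "Y1 = of_rat y1" and "Y2 = of_rat y2"
          and "Y3 = of_rat (-(l*x3+k))" and "L = of_rat l" and "K = of_rat k"
        note defs = this
        have nz: "X1 \<noteq> 0" "X2 \<noteq> 0" "X3 \<noteq> 0" "Y1 \<noteq> 0" "Y2 \<noteq> 0" "Y3 \<noteq> 0"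
            "X1 + 2*\<i> \<noteq> 0" "X2 + 2*\<i> \<noteq> 0" "X3 + 2*\<i> \<noteq> 0"
          using 4 y0 by (simp_all add: defs del: of_rat_minus)
        have S: "X1+X2+X3 = L^2-12" "X1*X2+X1*X3+X2*X3 = -4-2*L*K" "X1*X2*X3 = K^2"
          using s[THEN arg_cong, of "of_rat :: rat \<Rightarrow> complex"] by (simp_all add: defs of_rat_dist)
        have Y: "Y1 = L*X1+K" "Y2 = L*X2+K" "Y3 = -(L*X3+K)"
          using y by (simp_all add: defs of_rat_dist)
        have U: "X3*(Y1*Y2*(X1+2*\<i>)*(X2+2*\<i>) + (12-4*\<i>)*X1*(X1-2*\<i>)*X2*(X2-2*\<i>)) =
            Y3*(X1*Y2*(X2-2*\<i>)*(X1+2*\<i>) + X2*Y1*(X1-2*\<i>)*(X2+2*\<i>))"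
          by (rule collinear_u[OF _ S Y]) simp
        have V: "(X3-2*\<i>)*(Y1*Y2*(X1+2*\<i>)*(X2+2*\<i>) - (12-4*\<i>)*X1*(X1-2*\<i>)*X2*(X2-2*\<i>)) =
            (X3+2*\<i>)*(Y1*Y2*(X1-2*\<i>)*(X2-2*\<i>) - (12+4*\<i>)*X1*X2*(X1+2*\<i>)*(X2+2*\<i>))"
          by (rule collinear_v[OF _ S Y]) simp
        define u3 v3 where "u3 = X3 / Y3" and "v3 = (X3-2*\<i>) / (X3+2*\<i>)"
        define Z1 Z2 Z3 where "Z1 = X1+2*\<i>" and "Z2 = X2+2*\<i>" and "Z3 = X3+2*\<i>"
        note Z = this
        have uv': "u1*Y1 = X1" "v1*Z1 = X1-2*\<i>" "u2*Y2 = X2" "v2*Z2 = X2-2*\<i>"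
            "u3*Y3 = X3" "v3*Z3 = X3-2*\<i>"
          using uv P Q nz by (auto simp: defs Z u3_def v3_def)
        define D where "D = Y1*Y2*Z1*Z2"
        have "Y3*D*(u3*(1 + (12-4*\<i>)*u1*v1*u2*v2)) = Y3*D*(u1*v2+u2*v1)"
          using U[folded Z, folded uv'] unfolding D_def by (simp add: algebra_simps)
        moreover have "Z3*D*(v3*(1 - (12-4*\<i>)*u1*v1*u2*v2)) = Z3*D*(v1*v2-(12+4*\<i>)*u1*u2)"
          using V[folded Z, folded uv'] unfolding D_def by (simp add: algebra_simps)
        ultimately have "ed_E (u1, v1) (u2, v2) = (u3, v3)"
          using nz by (intro ed_addI df) (simp_all add: D_def Z)
        moreover have "psi (P \<uplus> Q) = (u3, v3)"
          by (simp only: P Q sum) (simp add: u3_def v3_def defs)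
        ultimately show ?thesis using uv by simp
      qed
    qed
  qed
qed

section \<open>The abelian group of rational points\<close>

fun neg_E :: "ec_point \<Rightarrow> ec_point" where
  "neg_E Infinity = Infinity"
| "neg_E (Affine x y) = Affine x (- y)"

abbreviation "G_E \<equiv> ec_group 12 (-4) 0"

lemma carrier_E [simp]: "P \<in> carrier G_E \<longleftrightarrow> on_E P"
  by (simp add: ec_group_def)

lemma mult_E [simp]: "P \<otimes>\<^bsub>G_E\<^esub> Q = P \<uplus> Q"
  by (simp add: ec_group_def)

lemma one_E [simp]: "\<one>\<^bsub>G_E\<^esub> = Infinity"
  by (simp add: ec_group_def)

lemma add_E_assoc:
  assumes "on_E P" "on_E Q" "on_E R" shows "P \<uplus> Q \<uplus> R = P \<uplus> (Q \<uplus> R)"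
proof (rule psi_inj)
  show "psi (P \<uplus> Q \<uplus> R) = psi (P \<uplus> (Q \<uplus> R))"
    using ed_add_assoc[OF psi_curve psi_curve psi_curve psi_defined psi_defined, of P Q R]
      psi_defined[of "P \<uplus> Q" R] psi_defined[of P "Q \<uplus> R"] assms
    by (simp add: psi_add on_E_add)
qed (use assms on_E_add in auto)

lemma add_E_commute:
  assumes "on_E P" "on_E Q" shows "P \<uplus> Q = Q \<uplus> P"
proof (rule psi_inj)
  show "psi (P \<uplus> Q) = psi (Q \<uplus> P)"
    using assms by (cases "psi P"; cases "psi Q") (simp add: psi_add ed_add_def mult_ac add_ac)
qed (use assms on_E_add in auto)

lemma comm_group_E: "comm_group G_E"
proof (rule comm_groupI)
  fix P assume P: "P \<in> carrier G_E"
  then have "on_E (neg_E P)" "neg_E P \<uplus> P = Infinity" by (cases P; simp)+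
  then show "\<exists>Q\<in>carrier G_E. Q \<otimes>\<^bsub>G_E\<^esub> P = \<one>\<^bsub>G_E\<^esub>" by auto
next
  show "P \<otimes>\<^bsub>G_E\<^esub> Q = Q \<otimes>\<^bsub>G_E\<^esub> P" if "P \<in> carrier G_E" "Q \<in> carrier G_E" for P Q
    using that by (simp add: add_E_commute)
qed (auto simp: on_E_add add_E_assoc)

section \<open>Heights and 2-descent\<close>

lemma squarefree_dvd_square:
  fixes d n :: int
  assumes "squarefree d" "d dvd n^2" shows "d dvd n"
proof -
  have "d \<noteq> 0" using assms(1) by auto
  then obtain d' n' where dn: "d = d' * gcd d n" "n = n' * gcd d n" "coprime d' n'"
    using gcd_coprime_exists[of d n] by auto
  define g where "g = gcd d n"
  have g: "d = d' * g" "n = n' * g" "g \<noteq> 0" using dn \<open>d \<noteq> 0\<close> by (auto simp: g_def)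
  have "d' * g dvd (n'^2 * g) * g" using assms(2) g by (simp add: power2_eq_square ac_simps)
  then have "d' dvd n'^2 * g" using g(3) by (auto simp only: dvd_mult_cancel_right)
  then have "d' dvd g" using dn(3) by (simp add: coprime_dvd_mult_right_iff)
  then have "d'^2 dvd d" using g(1) by (simp add: power2_eq_square)
  then have "is_unit d'" using assms(1) by (blast dest: squarefreeD)
  then show ?thesis using g by (metis dvd_mult mult_unit_dvd_iff' dvd_refl)
qed

text \<open>The squarefree part of \<open>p\<close>, with its sign, also serves for
  \<open>m\<close>. In the descent this is applied first to a denominator and then to a
  numerator.\<close>

lemma product_square_decomp:
  fixes p m n :: int
  assumes "p \<noteq> 0" "p * m = n^2"
  obtains d s k where "squarefree d" "p = d * s^2" "m = d * k^2"
proof -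
  define d where "d = squarefree_part p"
  define s where "s = square_part p"
  have p: "p = d * s^2" unfolding d_def s_def by (rule squarefree_decompose)
  have "s^2 dvd n^2" using assms(2) p by (metis dvd_triv_left mult.assoc mult.commute)
  then obtain n' where n: "n = s * n'" by (auto elim: dvdE)
  have s0: "s \<noteq> 0" "d \<noteq> 0" using assms(1) p by auto
  then have dm: "d * m = n'^2" using assms(2) p n by (simp add: power_mult_distrib) 
  have "squarefree d" by (simp add: d_def)
  then have "d dvd n'" using dm squarefree_dvd_square by (metis dvd_triv_left)
  then obtain k where "n' = d * k" ..
  then have "m = d * k^2" using dm s0 by (simp add: power2_eq_square)
  then show thesis using that \<open>squarefree d\<close> p by blast
qed

text \<open>A bound on the naive height of the abscissa. The fraction need not be in lowest terms,
  so any representation of \<open>x\<close> certifies a bound.\<close>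

definition ht :: "int \<Rightarrow> ec_point \<Rightarrow> bool" where
  "ht B P \<longleftrightarrow> (case P of Infinity \<Rightarrow> True | Affine x y \<Rightarrow>
     \<exists>p q. q \<noteq> 0 \<and> \<bar>p\<bar> \<le> B \<and> \<bar>q\<bar> \<le> B \<and> x = of_int p / of_int q)"

lemma ht_Infinity [simp]: "ht B Infinity" by (simp add: ht_def)

lemma ht_AffineI: "q \<noteq> 0 \<Longrightarrow> \<bar>p\<bar> \<le> B \<Longrightarrow> \<bar>q\<bar> \<le> B \<Longrightarrow> x = of_int p / of_int q \<Longrightarrow> ht B (Affine x y)"
  by (auto simp: ht_def)

lemma ht_mono: "ht B P \<Longrightarrow> B \<le> C \<Longrightarrow> ht C P"
  by (auto simp: ht_def split: ec_point.splits) force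

lemma ht_exists: "\<exists>B. ht B P"
proof (cases P)
  case (Affine x y)
  obtain p q where "x = of_int p / of_int q" "q > 0" by (metis quotient_of_div quotient_of_denom_pos surj_pair)
  then have "ht (max \<bar>p\<bar> \<bar>q\<bar>) P" unfolding Affine by (intro ht_AffineI[of q p]) auto
  then show ?thesis ..
qed simp

lemma finite_ht: "finite {P. on_E P \<and> ht B P}"
proof -
  define X where "X = (\<lambda>(p, q). of_int p / of_int q :: rat) ` ({-B..B} \<times> {-B..B})"
  have X: "finite X" by (simp add: X_def)
  have Y: "finite {y. y^2 = c}" for c :: rat
  proof (cases "\<exists>z. z^2 = c")
    case True
    then obtain z where "z^2 = c" ..
    then have "{y. y^2 = c} \<subseteq> {z, -z}" by (auto simp: power2_eq_iff)
    then show ?thesis by (rule finite_subset) simp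
  qed auto
  have "{P. on_E P \<and> ht B P} \<subseteq> {Infinity} \<union> (\<Union>x\<in>X. Affine x ` {y. y^2 = x^3+12*x^2-4*x})"
  proof
    fix P assume P: "P \<in> {P. on_E P \<and> ht B P}"
    show "P \<in> {Infinity} \<union> (\<Union>x\<in>X. Affine x ` {y. y^2 = x^3+12*x^2-4*x})"
    proof (cases P)
      case (Affine x y)
      then have "x \<in> X" using P by (fastforce simp: X_def ht_def)
      then show ?thesis using P Affine by auto
    qed simp
  qed
  then show ?thesis using X Y by (elim finite_subset) auto
qed

section \<open>Translation by (0,0) and by (1,3), and its effect on heights\<close>

abbreviation "T_E \<equiv> Affine 0 0"
abbreviation "P_E \<equiv> Affine 1 3"

lemma on_E_TP [simp]: "on_E T_E" "on_E P_E" by simp_all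

lemma add_T:
  assumes "on_E (Affine x y)" "x \<noteq> 0"
  shows "Affine x y \<uplus> T_E = Affine (-4/x) (4*y/x^2)"
proof -
  have "y^2 = x^3+12*x^2-4*x" using assms by simp
  then have "y^2 / x^2 = x + 12 - 4 / x"
    using assms(2) by (simp add: field_simps power2_eq_square power3_eq_cube)
  then have "(y/x)^2 - 12 - x = -4/x" by (simp add: power_divide)
  moreover have "y/x * (x - -4/x) - y = 4*y/x^2" using assms(2) by (simp add: field_simps power2_eq_square)
  moreover have "Affine x y \<uplus> T_E = (let l = y/x; x3 = l^2 - 12 - x in Affine x3 (l * (x - x3) - y))"
    using assms(2) by (simp add: Let_def)
  ultimately show ?thesis by (simp only: Let_def)
qed

lemma add_P:
  assumes "on_E (Affine x y)" "x \<noteq> 1"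
  shows "\<exists>z. Affine x y \<uplus> P_E = Affine ((x^2+21*x-4-6*y)/(x-1)^2) z"
proof -
  have f: "y^2 = x^3+12*x^2-4*x" using assms by simp
  have "((3-y)/(1-x))^2 - 12 - x - 1 = (x^2+21*x-4-6*y)/(x-1)^2"
  proof -
    have nz: "1 - x \<noteq> 0" "x - 1 \<noteq> 0" using assms(2) by auto
    have "(3-y)^2 - (13+x)*(x-1)^2 = x^2+21*x-4-6*y" using f by algebra
    moreover have "(1-x)^2 = (x-1)^2" by algebra
    ultimately show ?thesis using nz by (simp add: power_divide field_simps)
  qed
  then show ?thesis using assms(2) by (simp add: Let_def)
qed

lemma ht_add_T:
  assumes "on_E P" "ht B P" "B \<ge> 1" shows "ht (4*B) (P \<uplus> T_E)"
proof (cases P)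
  case Infinity then show ?thesis using assms(3) by (auto intro: ht_AffineI[of 1 0])
next
  case (Affine x y)
  show ?thesis
  proof (cases "x = 0")
    case True then show ?thesis using Affine assms by simp
  next
    case False
    obtain p q where pq: "q \<noteq> 0" "\<bar>p\<bar> \<le> B" "\<bar>q\<bar> \<le> B" "x = of_int p / of_int q"
      using assms Affine by (auto simp: ht_def)
    then have "p \<noteq> 0" using False by auto
    then have "ht (4*B) (Affine (-4/x) z)" for z using pq by (intro ht_AffineI[of p "-4*q"]) auto
    then show ?thesis using add_T assms Affine False by simp
  qed
qed

text \<open>Translation by a fixed point at most squares the height, up to a constant: for
  \<open>x = p/q\<close> the number \<open>R = q^2 y\<close> is an integer of size at most
  \<open>5*B^2\<close>, and the new abscissa is a quotient of quadratic expressions in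
  \<open>p\<close>, \<open>q\<close> with a multiple of \<open>R\<close> added to the
  numerator.\<close>

lemma ht_add_P:
  assumes "on_E P" "ht B P" "B \<ge> 1" shows "ht (60*B^2) (P \<uplus> P_E)"
proof -
  have B2: "B^2 \<ge> 1" using assms(3) by simp
  show ?thesis
  proof (cases P)
    case Infinity then show ?thesis using B2 by (auto intro: ht_AffineI[of 1 1])
  next
    case (Affine x y)
    have f: "y^2 = x^3+12*x^2-4*x" using assms Affine by simp
    show ?thesis
    proof (cases "x = 1")
      case True
      then have "y^2 = 3^2" using f by simp
      then consider "y = 3" | "y = -3" by (metis power2_eq_iff)
      then show ?thesis
      proof cases
        case 1
        then have "P \<uplus> P_E = Affine (25/36) (-395/216)" using True Affine by (simp add: Let_def field_simps)
        then show ?thesis using B2 by (auto intro: ht_AffineI[of 36 25])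
      next
        case 2 then show ?thesis using True Affine by simp
      qed
    next
      case False
      obtain p q where pq: "q \<noteq> 0" "\<bar>p\<bar> \<le> B" "\<bar>q\<bar> \<le> B" "x = of_int p / of_int q"
        using assms Affine by (auto simp: ht_def)
      define N where "N = p*q*(p^2+12*p*q-4*q^2)"
      have x: "x * of_int q = of_int p" using pq by simp
      have "(of_int (q^2) * y)^2 = of_int N"
        using f unfolding N_def of_int_mult of_int_add of_int_diff of_int_power of_int_numeral x[symmetric] by algebra
      then obtain R where R: "of_int (q^2) * y = of_int R" "R^2 = N" using int_sqrt_rat by blast
      have pp: "p^2 \<le> B^2" "q^2 \<le> B^2" using pq(2,3) by (metis abs_ge_zero power2_abs power_mono)+
      have pqB: "\<bar>p*q\<bar> \<le> B^2" using pq(2,3) assms(3) by (auto simp: abs_mult power2_eq_square intro: mult_mono)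
      have "\<bar>p^2+12*p*q-4*q^2\<bar> \<le> 17*B^2" unfolding mult.assoc using pp pqB zero_le_power2[of p] zero_le_power2[of q]
        by linarith
      then have "\<bar>N\<bar> \<le> B^2*(17*B^2)" unfolding N_def abs_mult[of "p*q"] using pqB B2 by (intro mult_mono) auto
      then have "R^2 \<le> B^2*(17*B^2)" using R by auto
      also have "\<dots> \<le> (5*B^2)^2" using assms(3) by (simp add: power2_eq_square zero_le_mult_iff)
      finally have RB: "\<bar>R\<bar> \<le> 5*B^2" using abs_le_square_iff[of R "5*B^2"] B2 by auto
      have pqn: "p - q \<noteq> 0" using False pq by auto
      have "(x^2+21*x-4-6*y)/(x-1)^2 = of_int (p^2+21*p*q-4*q^2-6*R) / of_int ((p-q)^2)"
      proof -
        have "(x^2+21*x-4-6*y) * of_int ((p-q)^2) = of_int (p^2+21*p*q-4*q^2-6*R) * (x-1)^2"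
          unfolding of_int_mult of_int_add of_int_diff of_int_power of_int_numeral R(1)[symmetric] x[symmetric] by algebra
        moreover have "of_int ((p-q)^2) \<noteq> (0::rat)" "(x-1)^2 \<noteq> 0" using pqn False by simp_all
        ultimately show ?thesis by (simp add: frac_eq_eq)
      qed
      moreover have "\<bar>p^2+21*p*q-4*q^2-6*R\<bar> \<le> 60*B^2" unfolding mult.assoc using pp pqB RB zero_le_power2[of p] zero_le_power2[of q]
        by linarith
      moreover have "\<bar>(p-q)^2\<bar> \<le> 60*B^2"
      proof -
        have "(p-q)^2 = p^2 - 2*(p*q) + q^2" by (simp add: power2_eq_square algebra_simps)
        then show ?thesis using pp pqB zero_le_power2[of p] zero_le_power2[of q] by linarith
      qed
      ultimately show ?thesis using add_P[of x y] assms Affine False pqn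
        by (auto intro!: ht_AffineI[of "(p-q)^2" "p^2+21*p*q-4*q^2-6*R"] simp del: ec_add.simps of_int_power of_int_diff of_int_add)
    qed
  qed
qed

section \<open>Duplication and heights\<close>

lemma double_E:
  assumes "on_E (Affine x y)" "x \<noteq> 0"
  shows "\<exists>z. Affine x y \<uplus> Affine x y = Affine ((x^2+4)^2 / (4*x*(x^2+12*x-4))) z"
proof -
  have y: "y \<noteq> 0" using on_E_y_eq_0 assms by blast
  have f: "y^2 = x*(x^2+12*x-4)" using assms by (simp add: algebra_simps power2_eq_square power3_eq_cube)
  have "(a/(2*y))^2 - 12 - x - x = (a^2 - (12 + 2*x)*(4*y^2)) / (4*y^2)" for a
    using y by (simp add: field_simps power2_eq_square)
  then have "((3*x^2+24*x-4)/(2*y))^2 - 12 - x - x = ((3*x^2+24*x-4)^2 - (12 + 2*x)*(4*y^2)) / (4*y^2)" .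
  \<comment> \<open>For \<open>y^2 = x^3 + a x^2 + b x\<close> the duplication formula has numerator
    \<open>(x^2 - b)^2\<close> and denominator \<open>4 y^2\<close>; here
    \<open>b = -4\<close>.\<close>
  also have "(3*x^2+24*x-4)^2 - (12 + 2*x)*(4*y^2) = (x^2+4)^2" unfolding f by algebra
  also have "4*y^2 = 4*x*(x^2+12*x-4)" unfolding f by simp
  finally show ?thesis using y by (simp add: Let_def)
qed

text \<open>This bounds the cancellation in the duplication formula at a reduced fraction
  \<open>p/q\<close>: a common divisor divides \<open>10240*p^7\<close> and
  \<open>10240*q^7\<close>, and these powers are coprime.\<close>

lemma double_gcd:
  fixes p q :: int
  assumes "coprime p q"
  shows "gcd ((p^2+4*q^2)^2) (4*p*q*(p^2+12*p*q-4*q^2)) dvd 10240" (is "gcd ?N ?D dvd _")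
proof -
  txt \<open>Cofactors expressing the resultant of the two forms.\<close>
  have "(40*p^3+24*p^2*q-12*p*q^2) * ?N + (-6*p^3-5*p^2*q-12*p*q^2-12*q^3) * ?D = 40*p^7" by algebra
  then have "gcd ?N ?D dvd 40*p^7" by (metis dvd_add dvd_mult gcd_dvd1 gcd_dvd2)
  then have p: "gcd ?N ?D dvd 10240*p^7" by (rule dvd_trans) simp
  have "(-12*p^2*q-96*p*q^2+640*q^3) * ?N + (3*p^3-12*p^2*q+20*p*q^2-96*q^3) * ?D = 10240*q^7" by algebra
  then have q: "gcd ?N ?D dvd 10240*q^7" by (metis dvd_add dvd_mult gcd_dvd1 gcd_dvd2)
  have "gcd ?N ?D dvd gcd (10240*p^7) (10240*q^7)" using p q by simp
  also have "gcd (10240*p^7) (10240*q^7) = 10240 * gcd (p^7) (q^7)" by (simp add: gcd_mult_left)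
  also have "gcd (p^7) (q^7) = 1" using assms by simp
  finally show ?thesis by simp
qed

text \<open>The unreduced numerator \<open>N\<close> of the doubled abscissa is at least
  \<open>|p|^4\<close> and \<open>|q|^4\<close>, while cancellation removes a factor of at most
  10240. So halving takes a fourth root of the height, up to a constant.\<close>

lemma ht_halve:
  assumes "on_E Q" "ht B (Q \<uplus> Q)" "10240*B \<le> C^4" "C \<ge> 1"
  shows "ht C Q"
proof (cases Q)
  case (Affine x y)
  show ?thesis
  proof (cases "x = 0")
    case True then show ?thesis using assms(4) Affine by (auto intro: ht_AffineI[of 1 0])
  next
    case False
    obtain p q where "quotient_of x = (p, q)" by fastforce
    then have pq: "x = of_int p / of_int q" "q > 0" "coprime p q"
      by (simp_all add: quotient_of_div quotient_of_denom_pos quotient_of_coprime)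
    then have p: "p \<noteq> 0" using False by auto
    define N D where "N = (p^2+4*q^2)^2" and "D = 4*p*q*(p^2+12*p*q-4*q^2)"
    have "on_E (Affine x y)" using assms(1) Affine by simp
    then obtain z where z: "Affine x y \<uplus> Affine x y = Affine ((x^2+4)^2 / (4*x*(x^2+12*x-4))) z"
      using double_E False by blast
    then obtain a b where ab: "b \<noteq> 0" "\<bar>a\<bar> \<le> B" "\<bar>b\<bar> \<le> B"
        "(x^2+4)^2 / (4*x*(x^2+12*x-4)) = of_int a / of_int b"
      using assms(2) Affine by (auto simp: ht_def simp del: ec_add.simps)
    have "x*(x^2+12*x-4) \<noteq> 0"
    proof
      assume "x*(x^2+12*x-4) = 0"
      then have "x^3+12*x^2-4*x = 0" by algebra
      then show False using on_E_y_eq_0 assms(1) Affine False by fastforce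
    qed
    then have "4*x*(x^2+12*x-4) \<noteq> 0" by simp
    then have "(x^2+4)^2 * of_int b = of_int a * (4*x*(x^2+12*x-4))"
      using ab by (simp add: frac_eq_eq)
    moreover have x: "of_int p = x * of_int q" using pq by simp
    ultimately have "of_int (N * b) = (of_int (a * D) :: rat)"
      unfolding N_def D_def of_int_mult of_int_add of_int_diff of_int_power of_int_numeral x by algebra
    then have ND: "N * b = a * D" by (simp only: of_int_eq_iff)
    have "p^2 + 4*q^2 > 0" using p by (simp add: add_pos_nonneg)
    then have N: "N > 0" by (simp add: N_def)
    obtain N' D' where g: "N = N' * gcd N D" "D = D' * gcd N D" "coprime N' D'"
      using gcd_coprime_exists[of N D] N by auto
    have g0: "gcd N D > 0" using N by (simp add: gcd_pos_int)
    have "gcd N D * (N' * b) = gcd N D * (a * D')" using ND g by (metis mult.assoc mult.commute)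
    then have "N' * b = a * D'" using g0 by (metis less_irrefl mult_cancel_left)
    then have "N' dvd a" using g(3) by (metis coprime_dvd_mult_left_iff dvd_triv_left)
    moreover have "a \<noteq> 0" using ND N ab by auto
    ultimately have "\<bar>N'\<bar> \<le> \<bar>a\<bar>" by (simp add: dvd_imp_le_int)
    then have N': "N' \<le> B" using ab by simp
    have "gcd N D \<le> 10240" using double_gcd[OF pq(3)] unfolding N_def D_def by (rule zdvd_imp_le) simp
    moreover have "N' > 0" using g(1) N g0 by (metis zero_less_mult_pos2)
    ultimately have "N \<le> B * 10240" using N' g0 by (subst g(1)) (intro mult_mono; simp)
    then have "N \<le> C^4" using assms(3) by simp
    moreover have "\<bar>p\<bar>^4 \<le> N"
      using power_mono[of "p^2" "p^2+4*q^2" 2] by (simp add: N_def flip: power_mult)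
    moreover have "\<bar>q\<bar>^4 \<le> N"
      using power_mono[of "q^2" "p^2+4*q^2" 2] by (simp add: N_def flip: power_mult)
    ultimately have "\<bar>p\<bar>^4 \<le> C^4" "\<bar>q\<bar>^4 \<le> C^4" by linarith+
    then have "\<bar>p\<bar> \<le> C" "\<bar>q\<bar> \<le> C" using assms(4) by (meson linorder_not_le power_strict_mono abs_ge_zero order_trans zero_le_one zero_less_numeral)+
    then show ?thesis using pq Affine by (auto intro: ht_AffineI[of q p])
  qed
qed simp

text \<open>\<open>d\<close> is the class of \<open>x\<close> modulo squares, and \<open>(s, e, m)\<close> lies on the 2-covering attached to it.\<close>

lemma descent_class:
  fixes x y :: rat and a b :: int
  assumes f: "y^2 = x^3 + of_int a*x^2 + of_int b*x" and "x \<noteq> 0"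
  obtains d s e m :: int where "squarefree d" "d dvd b" "e \<noteq> 0" "s \<noteq> 0" "coprime (d*s) e"
    "x = of_int d * (of_int s / of_int e)^2" "d*m^2 = d^2*s^4 + a*d*s^2*e^2 + b*e^4"
proof -
  obtain p q where "quotient_of x = (p, q)" by fastforce
  then have pq: "x = of_int p / of_int q" "q > 0" "coprime p q"
    by (simp_all add: quotient_of_div quotient_of_denom_pos quotient_of_coprime)
  then have p: "p \<noteq> 0" using assms by auto
  define M where "M = p^2+a*p*q+b*q^2"
  have x: "of_int p = x * of_int q" using pq by simp
  have "(of_int (q^2) * y)^2 = of_int (q * (p * M))"
    using f unfolding M_def of_int_mult of_int_add of_int_diff of_int_power x by algebra
  then obtain R where R: "q * (p * M) = R^2" using int_sqrt_rat by metis
  obtain c e k where c: "squarefree c" "q = c * e^2" "p * M = c * k^2"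
    using product_square_decomp[OF _ R] pq by auto
  have "coprime q (p * M)"
  proof -
    have "coprime q (p^2)" using pq(3) by (simp add: coprime_commute)
    then have "coprime q (p^2 + (a*p + b*q)*q)" by (metis add.commute coprime_iff_gcd_eq_1 gcd_add_mult mult.commute)
    then have "coprime q M" by (simp add: M_def algebra_simps power2_eq_square)
    then show ?thesis using pq(3) by (simp add: coprime_commute)
  qed
  \<comment> \<open>The class \<open>c\<close> divides both \<open>q\<close> and
    \<open>p * M\<close>, which are coprime, so the denominator is a square up to sign.\<close>
  then have "is_unit c" using c by (metis coprime_common_divisor dvd_triv_left)
  moreover have "c > 0" using pq(2) c(2) by (metis zero_less_mult_pos2 zero_le_power2 linorder_neqE_linordered_idom mult_nonpos_nonneg not_less order_less_le)
  ultimately have c1: "c = 1" by simp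
  obtain d s m where d: "squarefree d" "p = d * s^2" "M = d * m^2"
    using product_square_decomp[OF p, of M k] c c1 by auto
  have q: "q = e^2" using c c1 by simp
  \<comment> \<open>\<open>d\<close> divides \<open>p\<close> and \<open>M\<close>, hence
    \<open>b * q^2\<close>, and it is coprime to \<open>q\<close>.\<close>
  have "d dvd M - p*(p + a*q)" using d by simp
  also have "M - p*(p + a*q) = b * q^2" by (simp add: M_def power2_eq_square algebra_simps)
  finally have "d dvd b" using pq(3) d(2) by (simp add: coprime_dvd_mult_left_iff)
  moreover have "coprime (d*s) e" using pq(3) d(2) q by simp
  moreover have "d*m^2 = d^2*s^4 + a*d*s^2*e^2 + b*e^4"
    using d(3) unfolding M_def d(2) q by (simp add: power_mult_distrib flip: power_mult)
  moreover have "e \<noteq> 0" "s \<noteq> 0" using q pq(2) p d(2) by auto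
  moreover have "x = of_int d * (of_int s / of_int e)^2" using pq(1) d(2) q by (simp add: power_divide)
  ultimately show thesis using that d(1) by blast
qed

section \<open>The possible square classes of abscissas\<close>

lemma odd_square_mod_8: "odd (s::int) \<Longrightarrow> \<exists>k. s^2 = 8*k+1"
proof -
  assume "odd s"
  then obtain k where s: "s = 2*k+1" by (rule oddE)
  have "even (k*(k+1))" by simp
  then obtain j where "k*(k+1) = 2*j" ..
  then have "s^2 = 8*j+1" using s by algebra
  then show ?thesis ..
qed

lemma square_mod_8_ne_3: "(n::int)^2 \<noteq> 8*k+3"
proof
  assume *: "n^2 = 8*k+3"
  show False
  proof (cases "even n")
    case True
    then have "even (n^2)" by simp
    then show False using * by simp
  next
    case False
    then obtain j where "n^2 = 8*j+1" using odd_square_mod_8 by blast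
    then show False using * by presburger
  qed
qed

text \<open>A 2-adic obstruction to the classes 2 and -2: \<open>e\<close> and \<open>s\<close> are
  forced to be odd and \<open>m\<close> to be even, and cancelling powers of 2 leaves a square
  congruent to 3 modulo 8.\<close>

lemma no_class_2:
  fixes s e m d c :: int
  assumes "c = 1 \<or> c = -1" "d = 2*c" "coprime (d*s) e" "d*m^2 = d^2*s^4 + 12*d*s^2*e^2 - 4*e^4"
  shows False
proof -
  have c2: "c^2 = 1" using assms(1) by auto
  have e: "odd e" using assms(2,3) by (metis coprime_common_divisor coprime_mult_left_iff dvd_triv_left odd_one)
  have "2*(c*m^2) = 2*(2*(s^4 + 6*c*s^2*e^2 - e^4))" using assms(4) c2 unfolding assms(2) by algebra
  then have m: "c*m^2 = 2*(s^4 + 6*c*s^2*e^2 - e^4)" by simp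
  then have "even (c*m^2)" by simp
  then have "even m" using assms(1) by auto
  then obtain n where "m = 2*n" ..
  then have n: "2*(c*n^2) = s^4 + 6*c*s^2*e^2 - e^4" using m by (simp add: power_mult_distrib)
  then have "even (s^4 + 6*c*s^2*e^2 - e^4)" by (metis dvd_triv_left)
  then have "odd s" using e by auto
  then obtain i where i: "s^2 = 8*i+1" using odd_square_mod_8 by blast
  obtain j where j: "e^2 = 8*j+1" using odd_square_mod_8 e by blast
  have s4: "s^4 = (8*i+1)^2" "e^4 = (8*j+1)^2" using i j by (simp_all flip: i j power_mult)
  have "2*n^2 = 2*(8*(c*(4*i^2+i-4*j^2-j) + 24*i*j+3*i+3*j) + 3)"
    using n c2 unfolding s4 i j by algebra
  then show False using square_mod_8_ne_3 by (metis mult_cancel_left zero_neq_numeral)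
qed

lemma x_square_class:
  assumes "on_E (Affine x y)" "x \<noteq> 0"
  shows "\<exists>s. x = s^2 \<or> x = -(s^2)"
proof -
  have "y^2 = x^3 + of_int 12*x^2 + of_int (-4)*x" using assms(1) by simp
  then obtain d s e m :: int where d: "squarefree d" "d dvd -4" "coprime (d*s) e"
    "x = of_int d * (of_int s / of_int e)^2" "d*m^2 = d^2*s^4 + 12*d*s^2*e^2 + (-4)*e^4"
    using descent_class assms(2) by metis
  have "d dvd 2" using squarefree_dvd_square[OF d(1), of 2] d(2) by simp
  then have "\<bar>d\<bar> \<le> 2" "d \<noteq> 0" using zdvd_imp_le[of "\<bar>d\<bar>" 2] by auto
  then consider "d = 1" | "d = -1" | "d = 2*1" | "d = 2*(-1)" by linarith
  then show ?thesis
  proof cases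
    case 3 then show ?thesis using no_class_2[of 1 d s e m] d by simp
  next
    case 4 then show ?thesis using no_class_2[of "-1" d s e m] d by simp
  qed (use d in auto)
qed

text \<open>\<open>2 (s\<^sup>2 + 6 + t)\<close> is the abscissa of a preimage of \<open>(s\<^sup>2, s t)\<close> under the isogeny dual to
  \<open>(x, y) \<mapsto> (y\<^sup>2/x\<^sup>2, \<dots>)\<close>; replacing \<open>(s, t)\<close> by \<open>(-s, -t)\<close> gives the other preimage.\<close>

lemma halve_sq:
  assumes t: "t^2 = s^4+12*s^2-4" and w: "2*(s^2+6+t) = w^2"
  shows "\<exists>Q. on_E Q \<and> Q \<uplus> Q = Affine (s^2) (s*t)"
proof -
  \<comment> \<open>The line \<open>y = w x\<close> meets the curve, apart from (0,0), where
    \<open>x^2 + (12-w^2) x - 4 = 0\<close>. The discriminant is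
    \<open>w^4 - 24 w^2 + 160 = (2 s w)^2\<close>, and this is one of the two roots.\<close>
  define x where "x = (w^2-12)/2 + s*w"
  have "w^4 - 24*w^2 + 160 = 4*s^2*w^2" using t w by algebra
  then have "w \<noteq> 0" by auto
  have t2: "t = w^2/2 - s^2 - 6" using w by simp
  have x2: "x^2 + (12-w^2)*x - 4 = 0"
  proof -
    have "2*x = w^2 - 12 + 2*s*w" by (simp add: x_def)
    then have "4*(x^2 + (12-w^2)*x - 4) = 0" using \<open>w^4 - 24*w^2 + 160 = 4*s^2*w^2\<close> by algebra
    then show ?thesis by simp
  qed
  then have x0: "x \<noteq> 0" by auto
  have "(w*x)^2 = x^3 + 12*x^2 - 4*x" using x2 by algebra
  then have on: "on_E (Affine x (w*x))" by simp
  have "3*x^2 + 24*x - 4 = (w+s) * (2*(w*x))"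
  proof -
    have "2*x = w^2 - 12 + 2*s*w" by (simp add: x_def)
    then show ?thesis using x2 by algebra
  qed
  then have l: "(3*x^2 + 24*x - 4) / (2*(w*x)) = w+s" using x0 \<open>w \<noteq> 0\<close> by simp
  have "Affine x (w*x) \<uplus> Affine x (w*x) =
     (let l = (3*x^2 + 24*x - 4) / (2*(w*x)); x3 = l^2 - 12 - x - x in Affine x3 (l * (x - x3) - w*x))"
    using x0 \<open>w \<noteq> 0\<close> by (simp add: Let_def)
  also have "\<dots> = Affine ((w+s)^2 - 12 - x - x) ((w+s) * (x - ((w+s)^2 - 12 - x - x)) - w*x)"
    by (simp only: l Let_def)
  also have "(w+s)^2 - 12 - x - x = s^2" by (simp add: x_def power2_eq_square algebra_simps)
  also have "(w+s) * (x - s^2) - w*x = s*t" by (simp add: x_def t2 power2_eq_square field_simps)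
  finally show ?thesis using on by blast
qed

text \<open>The abscissa \<open>2 w^2\<close> on the isogenous curve has class 2, and so has 8, the
  abscissa of a point above (1,3). Adding \<open>P_E\<close> therefore moves to class 1, where
  \<open>halve_sq\<close> applies.\<close>

lemma halve_class_2:
  assumes t: "t^2 = s^4+12*s^2-4" and w: "s^2+6+t = w^2" and s: "s^2 \<noteq> 1"
  shows "\<exists>Q. on_E Q \<and> Q \<uplus> Q = Affine (s^2) (s*t) \<uplus> P_E"
proof -
  have r: "w^4 - 2*w^2*(s^2+6) + 40 = 0" using t w by algebra
  have w4: "w^2 - 4 \<noteq> 0"
  proof
    assume "w^2 - 4 = 0"
    then have "8*(s^2 - 1) = 0" using r by algebra
    then show False using s by simp
  qed
  have s1: "s^2 - 1 \<noteq> 0" using s by simp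
  txt \<open>On the isogenous curve \<open>Y\<^sup>2 = X\<^sup>3 - 24 X\<^sup>2 + 160 X\<close> the point above \<open>(s\<^sup>2, s t)\<close> is translated by \<open>(8, 16)\<close>,
    which lies above \<open>(1, 3)\<close>; \<open>w3\<^sup>2\<close> is the abscissa of the result.\<close>
  define s3 where "s3 = (3*s-t)/(s^2-1)"
  define w3 where "w3 = 4*w*(1+s)/(w^2-4)"
  define t3 where "t3 = w3^2/2 - s3^2 - 6"
  have on: "on_E (Affine (s^2) (s*t))" using t by (simp, algebra)
  have a: "s3*(s^2-1) = 3*s-t" "w3*(w^2-4) = 4*w*(1+s)" using s1 w4 by (simp_all add: s3_def w3_def)
  have "(w^2-4)^4*(s^2-1)^2*(w3^4 - 4*w3^2*(s3^2+6) + 160) = 0" using a r w by algebra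
  then have "w3^4 - 4*w3^2*(s3^2+6) + 160 = 0" using s1 w4 by simp
  moreover have "2*t3 = w3^2 - 2*(s3^2+6)" by (simp add: t3_def)
  ultimately have "4*t3^2 = 4*(s3^4+12*s3^2-4)" by algebra
  then have t3: "t3^2 = s3^4+12*s3^2-4" by simp
  have w3: "2*(s3^2+6+t3) = w3^2" by (simp add: t3_def)
  have "s^4+21*s^2-4-6*(s*t) = (3*s-t)^2" using t by algebra
  then have "((s^2)^2+21*s^2-4-6*(s*t)) / (s^2-1)^2 = s3^2" by (simp add: s3_def power_divide)
  then obtain z where z: "Affine (s^2) (s*t) \<uplus> P_E = Affine (s3^2) z" using add_P[OF on s] by auto
  have "on_E (Affine (s3^2) z)" using on_E_add[OF on] z by (metis on_E_TP(2))
  then have "z^2 = (s3*t3)^2" using t3 by (simp, algebra)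
  \<comment> \<open>\<open>add_P\<close> gives only the abscissa, so the ordinate is known up to
    sign; changing the sign of \<open>s3\<close> absorbs this.\<close>
  then consider "z = s3*t3" | "z = (-s3)*t3" by (auto simp: power2_eq_iff)
  then show ?thesis
  proof cases
    case 1 then show ?thesis using halve_sq[OF t3 w3] z by auto
  next
    case 2 then show ?thesis using halve_sq[of t3 "-s3" w3] t3 w3 z by auto
  qed
qed

lemma halve_square_x:
  assumes on: "on_E (Affine (s^2) y)" and s: "s \<noteq> 0"
  shows "\<exists>Q. on_E Q \<and> Q \<uplus> Q \<in> {Affine (s^2) y, Affine (s^2) y \<uplus> P_E}"
proof (cases "s^2 = 1")
  case True
  then have "y^2 = 3^2" using on by simp
  then consider "y = 3" | "y = -3" by (metis power2_eq_iff)
  then show ?thesis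
  proof cases
    case 1 then show ?thesis using True by (intro exI[of _ P_E]) simp
  next
    case 2 then show ?thesis using True by (intro exI[of _ Infinity]) simp
  qed
next
  case False
  define t where "t = y / s"
  have y: "y = s*t" using s by (simp add: t_def)
  have "(s*t)^2 = (s^2)^3 + 12*(s^2)^2 - 4*s^2" using on by (simp add: y)
  then have "s^2*t^2 = s^2*(s^4+12*s^2-4)" by algebra
  then have t: "t^2 = s^4+12*s^2-4" using s by simp
  \<comment> \<open>\<open>X\<close> and \<open>2*(s^2+6-t)\<close> are the abscissas of the two
    preimages on the isogenous curve. Their product is 160 and their sum is positive, so both are
    positive.\<close>
  define X where "X = 2*(s^2+6+t)"
  have X2: "X*(2*(s^2+6-t)) = 160" using t unfolding X_def by algebra
  then have X0: "X \<noteq> 0" by auto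
  have "X > 0"
  proof (rule ccontr)
    assume "\<not> X > 0"
    moreover from this have "\<not> 2*(s^2+6-t) > 0" using X2 X0 mult_neg_pos[of X "2*(s^2+6-t)"] by auto
    moreover have "X + 2*(s^2+6-t) = 4*(s^2+6)" by (simp add: X_def)
    moreover have "s^2+6 > 0" by (simp add: add_nonneg_pos)
    ultimately have "4*(s^2+6) \<le> 0" by (metis add_nonpos_nonpos not_less)
    then show False using \<open>s^2+6 > 0\<close> by (simp add: mult_le_0_iff)
  qed
  have "(2*s*X)^2 = X^3 - 24*X^2 + 160*X" using t unfolding X_def by algebra
  then have "(2*s*X)^2 = X^3 + of_int (-24)*X^2 + of_int 160*X" by simp
  then obtain d a b :: int where d: "squarefree d" "d dvd 160" "a \<noteq> 0" "b \<noteq> 0"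
    "X = of_int d * (of_int a / of_int b)^2" using descent_class X0 by metis
  define w :: rat where "w = of_int a / of_int b"
  have w: "w \<noteq> 0" "X = of_int d * w^2" using d by (simp_all add: w_def)
  have "(0::rat) < of_int d" using \<open>X > 0\<close> unfolding w(2) by (simp add: zero_less_mult_iff)
  then have "d > 0" by simp
  \<comment> \<open>As \<open>d\<close> is squarefree, divisibility descends from 160 through 40 and
    20 to 10.\<close>
  have "d dvd 40^2" using d(2) by (rule dvd_trans) simp
  then have "d dvd 40" by (rule squarefree_dvd_square[OF d(1)])
  then have "d dvd 20^2" by (rule dvd_trans) simp
  then have "d dvd 20" by (rule squarefree_dvd_square[OF d(1)])
  then have "d dvd 10^2" by (rule dvd_trans) simp
  then have d10: "d dvd 10" by (rule squarefree_dvd_square[OF d(1)])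
  then have "1 \<le> d" "d \<le> 10" using \<open>d > 0\<close> zdvd_imp_le[OF d10] by auto
  then have "d = 1 \<or> d = 2 \<or> d = 3 \<or> d = 4 \<or> d = 5 \<or> d = 6 \<or> d = 7 \<or> d = 8 \<or> d = 9 \<or> d = 10"
    by presburger
  then have d': "d \<in> {1, 2, 5, 10}" using d10 by auto
  \<comment> \<open>Passing to the other preimage replaces \<open>X\<close> by \<open>160/X\<close>.
    This exchanges class 1 with class 10 and class 2 with class 5, so the last two cases reduce to
    the first two.\<close>
  have conj: "2*((-s)^2+6+(-t)) = 160 / (of_int d * w^2)"
    using X2 X0 unfolding w(2)[symmetric] by (simp add: field_simps)
  have t': "(-t)^2 = (-s)^4+12*(-s)^2-4" using t by simp
  consider "d = 1" | "d = 2" | "d = 5" | "d = 10" using d' by blast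
  then show ?thesis
  proof cases
    case 1
    then have h: "2*(s^2+6+t) = w^2" using w X_def by simp
    show ?thesis using halve_sq[OF t h] unfolding y by blast
  next
    case 2
    then have h: "s^2+6+t = w^2" using w X_def by simp
    show ?thesis using halve_class_2[OF t h False] unfolding y by blast
  next
    case 3
    then have h: "(-s)^2+6+(-t) = (4/w)^2" using conj by (simp add: power_divide)
    have "(-s)^2 \<noteq> 1" using False by simp
    from halve_class_2[OF t' h this] show ?thesis unfolding y
      by (simp del: ec_add.simps) blast
  next
    case 4
    then have h: "2*((-s)^2+6+(-t)) = (4/w)^2" using conj by (simp add: power_divide)
    from halve_sq[OF t' h] show ?thesis unfolding y
      by (simp del: ec_add.simps) blast
  qed
qed

text \<open>Translation by (0,0) sends \<open>x\<close> to \<open>-4/x\<close>; this turns the class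
  -1 into the class 1, the one that \<open>halve_square_x\<close> handles.\<close>

lemma halve_E:
  assumes "on_E P"
  shows "\<exists>Q. on_E Q \<and> Q \<uplus> Q \<in> {P, P \<uplus> P_E, P \<uplus> T_E, P \<uplus> T_E \<uplus> P_E}"
proof (cases P)
  case Infinity
  then have "Infinity \<uplus> Infinity = P" "on_E Infinity" by simp_all
  then show ?thesis by blast
next
  case (Affine x y)
  show ?thesis
  proof (cases "x = 0")
    case True
    then have "y = 0" using on_E_y_eq_0 assms Affine by blast
    then have "P \<uplus> T_E = Infinity" using True Affine by simp
    then show ?thesis by (intro exI[of _ Infinity]) simp
  next
    case False
    then obtain s where "x = s^2 \<or> x = -(s^2)" using x_square_class assms Affine by blast
    then show ?thesis
    proof
      assume "x = s^2"
      then show ?thesis using halve_square_x[of s y] assms Affine False by (auto simp del: ec_add.simps)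
    next
      assume x: "x = -(s^2)"
      then have T: "P \<uplus> T_E = Affine ((2/s)^2) (4*y/x^2)"
        using add_T[of x y] assms Affine False by (simp add: power_divide del: ec_add.simps)
      have "on_E (P \<uplus> T_E)" using on_E_add[OF assms on_E_TP(1)] .
      then show ?thesis using halve_square_x[of "2/s" "4*y/x^2"] False x unfolding T
        by (auto simp del: ec_add.simps)
    qed
  qed
qed

text \<open>Iterating the step gives elements \<open>q k\<close> of \<open>S\<close> whose power
  \<open>2*2^k\<close> equals the square of \<open>P\<close> up to a power of \<open>g\<close>. Two
  of them coincide by finiteness, and eliminating the common element leaves a relation between
  \<open>P\<close> and \<open>g\<close> alone. Squares occur throughout so that 2-torsion drops
  out.\<close>

lemma (in comm_group) descent_dependent:
  assumes S: "finite S" "S \<subseteq> carrier G" and g: "g \<in> carrier G" and P: "P \<in> S"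
    and step: "\<And>q. q \<in> S \<Longrightarrow> \<exists>q'\<in>S. \<exists>i::int. q [^] (2::int) = q' [^] (4::int) \<otimes> g [^] i"
  shows "\<exists>(n::int) (k::int). n \<noteq> 0 \<and> P [^] n = g [^] k"
proof -
  have "\<exists>q\<in>S. \<exists>a::int. P [^] (2::int) = q [^] (2*2^k :: int) \<otimes> g [^] a" for k :: nat
  proof (induction k)
    case 0
    have "P [^] (2::int) = P [^] (2*2^0 :: int) \<otimes> g [^] (0::int)" using P S by auto
    then show ?case using P by blast
  next
    case (Suc k)
    then obtain q a where q: "q \<in> S" "P [^] (2::int) = q [^] (2*2^k :: int) \<otimes> g [^] (a::int)" by blast
    obtain q' i where q': "q' \<in> S" "q [^] (2::int) = q' [^] (4::int) \<otimes> g [^] (i::int)" using step q by blast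
    have c: "q \<in> carrier G" "q' \<in> carrier G" using q q' S by auto
    have "q [^] (2*2^k :: int) = (q' [^] (4::int) \<otimes> g [^] i) [^] (2^k :: int)"
      using c q' by (simp add: int_pow_pow flip: q'(2))
    also have "\<dots> = q' [^] (2*2^Suc k :: int) \<otimes> g [^] (i*2^k)"
      using c g by (simp add: int_pow_distrib int_pow_pow)
    finally have "P [^] (2::int) = q' [^] (2*2^Suc k :: int) \<otimes> g [^] (i*2^k + a)"
      using q c g by (simp add: int_pow_mult m_assoc)
    then show ?case using q' by blast
  qed
  then obtain q a where qa: "\<And>k::nat. q k \<in> S" "\<And>k. P [^] (2::int) = q k [^] (2*2^k :: int) \<otimes> g [^] (a k :: int)"
    by metis
  have "range q \<subseteq> S" using qa(1) by auto
  then have "\<not> inj q" using S(1) finite_subset range_inj_infinite by blast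
  then obtain j l where "q j = q l" "j < l" unfolding inj_def by (metis linorder_neqE_nat)
  then obtain d where l: "q (j + d) = q j" "d > 0" by (metis less_imp_add_positive)
  define r where "r = q j"
  have c: "r \<in> carrier G" "P \<in> carrier G" using qa S P by (auto simp: r_def)
  \<comment> \<open>The relation for index \<open>j\<close>, raised to the power \<open>2^d\<close>,
    contains the same power of \<open>r\<close> as the relation for index
    \<open>j + d\<close>.\<close>
  have "P [^] (2*2^d :: int) = (r [^] (2*2^j :: int) \<otimes> g [^] a j) [^] (2^d :: int)"
    using c by (simp add: int_pow_pow r_def flip: qa(2))
  also have "\<dots> = r [^] (2*2^(j+d) :: int) \<otimes> g [^] (a j * 2^d)"
    using c g by (simp add: int_pow_distrib int_pow_pow power_add mult_ac)
  also have "r [^] (2*2^(j+d) :: int) = P [^] (2::int) \<otimes> g [^] (- a (j+d))"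
    using qa(2)[of "j+d"] c g l by (simp add: r_def m_assoc flip: int_pow_mult)
  finally have "P [^] (2*2^d :: int) = P [^] (2::int) \<otimes> g [^] (a j * 2^d - a (j+d))"
    using c g by (simp add: m_assoc flip: int_pow_mult)
  then have "P [^] (2*2^d :: int) \<otimes> P [^] (-2::int) =
      (P [^] (2::int) \<otimes> P [^] (-2::int)) \<otimes> g [^] (a j * 2^d - a (j+d))"
    using c g by (metis int_pow_closed m_assoc m_comm)
  then have "P [^] (2*2^d + -2 :: int) = P [^] (2 + -2 :: int) \<otimes> g [^] (a j * 2^d - a (j+d))"
    using c by (simp only: int_pow_mult)
  then have "P [^] (2*2^d - 2 :: int) = g [^] (a j * 2^d - a (j+d))"
    using g by simp
  moreover have "(1::int) < 2^d" using one_less_power[of "2::int" d] l(2) by simp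
  then have "(2*2^d - 2 :: int) \<noteq> 0" by linarith
  ultimately show ?thesis by blast
qed

section \<open>The rank\<close>

text \<open>Squaring the halving relation kills \<open>t\<close>; the exponent \<open>i\<close> is
  then 0 or -2.\<close>

lemma (in comm_group) halving_step:
  assumes c: "q \<in> carrier G" "q' \<in> carrier G" "g \<in> carrier G" "t \<in> carrier G" and t: "t \<otimes> t = \<one>"
    and h: "q' \<otimes> q' \<in> {q, q \<otimes> g, q \<otimes> t, q \<otimes> t \<otimes> g}"
  shows "\<exists>i::int. q [^] (2::int) = q' [^] (4::int) \<otimes> g [^] i"
proof -
  have sq: "x [^] (2::int) = x \<otimes> x" if "x \<in> carrier G" for x
    using int_pow_mult[OF that, of 1 1] that by simp
  have t2: "t [^] (2::int) = \<one>" using t sq c by simp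
  have "q' [^] (4::int) = (q' \<otimes> q') [^] (2::int)" using c by (simp add: int_pow_pow flip: sq)
  also have "\<dots> = q [^] (2::int) \<or> \<dots> = q [^] (2::int) \<otimes> g [^] (2::int)"
  proof -
    have "q' \<otimes> q' = q \<or> q' \<otimes> q' = q \<otimes> g \<or> q' \<otimes> q' = q \<otimes> t \<or> q' \<otimes> q' = q \<otimes> t \<otimes> g" using h by simp
    then show ?thesis by (elim disjE; simp only:; simp add: int_pow_distrib t2 c)
  qed
  finally have "q' [^] (4::int) = q [^] (2::int) \<or> q' [^] (4::int) = q [^] (2::int) \<otimes> g [^] (2::int)" .
  then show ?thesis
  proof
    assume "q' [^] (4::int) = q [^] (2::int)"
    then have "q [^] (2::int) = q' [^] (4::int) \<otimes> g [^] (0::int)" using c by simp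
    then show ?thesis by blast
  next
    assume "q' [^] (4::int) = q [^] (2::int) \<otimes> g [^] (2::int)"
    then have "q [^] (2::int) = q' [^] (4::int) \<otimes> g [^] (-2::int)" using c by (simp add: m_assoc flip: int_pow_mult)
    then show ?thesis by blast
  qed
qed

lemma dependent_E:
  assumes P: "on_E P"
  shows "\<exists>(n::int) (k::int). n \<noteq> 0 \<and> P [^]\<^bsub>G_E\<^esub> n = P_E [^]\<^bsub>G_E\<^esub> k"
proof -
  interpret comm_group G_E by (rule comm_group_E)
  obtain B0 where B0: "ht B0 P" using ht_exists by blast
  \<comment> \<open>The translations raise the bound \<open>B\<close> to at most
    \<open>60*(4*B)^2 = 960*B^2\<close>. From 4000 on, \<open>10240*960*B^2 \<le> B^4\<close>, so
    \<open>ht_halve\<close> returns to the same bound and the descent stays in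
    \<open>S\<close>.\<close>
  define B where "B = max B0 4000"
  define S where "S = {P. on_E P \<and> ht B P}"
  have B: "B \<ge> 4000" by (simp add: B_def)
  have "\<exists>q'\<in>S. \<exists>i::int. q [^]\<^bsub>G_E\<^esub> (2::int) = q' [^]\<^bsub>G_E\<^esub> (4::int) \<otimes>\<^bsub>G_E\<^esub> P_E [^]\<^bsub>G_E\<^esub> i"
    if "q \<in> S" for q
  proof -
    have q: "on_E q" "ht B q" using that by (auto simp: S_def)
    obtain Q where Q: "on_E Q" "Q \<uplus> Q \<in> {q, q \<uplus> P_E, q \<uplus> T_E, q \<uplus> T_E \<uplus> P_E}" using halve_E q(1) by blast
    have T: "on_E (q \<uplus> T_E)" "ht (4*B) (q \<uplus> T_E)" using on_E_add[OF q(1) on_E_TP(1)] ht_add_T q B by auto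
    have le: "B \<le> 960*B^2" "4*B \<le> 960*B^2" using B by (simp_all add: power2_eq_square)
    have "ht (60*B^2) (q \<uplus> P_E)" using ht_add_P q B by auto
    then have "ht (960*B^2) (q \<uplus> P_E)" by (rule ht_mono) simp
    moreover have "ht (960*B^2) (q \<uplus> T_E \<uplus> P_E)" using ht_add_P[OF T] B by (simp add: power_mult_distrib)
    moreover have "ht (960*B^2) q" "ht (960*B^2) (q \<uplus> T_E)" using ht_mono q(2) T(2) le by blast+
    ultimately have "ht (960*B^2) (Q \<uplus> Q)" using Q(2) by auto
    moreover have "10240*(960*B^2) \<le> B^4"
    proof -
      have "4000^2 \<le> B^2" using B by (intro power_mono) auto
      then have "10240*960*B^2 \<le> B^2*B^2" by (intro mult_right_mono) auto
      then show ?thesis by (simp add: power2_eq_square power4_eq_xxxx mult_ac)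
    qed
    ultimately have "ht B Q" using ht_halve[OF Q(1)] B by simp
    then have "Q \<in> S" using Q by (simp add: S_def)
    moreover have "\<exists>i::int. q [^]\<^bsub>G_E\<^esub> (2::int) = Q [^]\<^bsub>G_E\<^esub> (4::int) \<otimes>\<^bsub>G_E\<^esub> P_E [^]\<^bsub>G_E\<^esub> i"
    proof (rule halving_step[where t = T_E])
      show "T_E \<otimes>\<^bsub>G_E\<^esub> T_E = \<one>\<^bsub>G_E\<^esub>" by simp
      show "Q \<otimes>\<^bsub>G_E\<^esub> Q \<in> {q, q \<otimes>\<^bsub>G_E\<^esub> P_E, q \<otimes>\<^bsub>G_E\<^esub> T_E, q \<otimes>\<^bsub>G_E\<^esub> T_E \<otimes>\<^bsub>G_E\<^esub> P_E}"
        using Q(2) by (simp del: ec_add.simps)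
    qed (use q Q in simp_all)
    ultimately show ?thesis by blast
  qed
  moreover have "finite S" "S \<subseteq> carrier G_E" using finite_ht by (auto simp: S_def)
  moreover have "P \<in> S" using P B0 ht_mono[of B0 P B] by (simp add: S_def B_def)
  ultimately show ?thesis using descent_dependent[of S P_E P] by simp
qed

section \<open>The point (1,3) has infinite order\<close>

lemma inverse_double:
  assumes "on_E (Affine x y)" "x \<noteq> 0" and w: "1/x = of_int a / of_int n" "n \<noteq> 0"
  shows "\<exists>x' y'. Affine x y \<uplus> Affine x y = Affine x' y' \<and>
     1/x' = of_int (4*a*n*(n^2+12*a*n-4*a^2)) / of_int ((n^2+4*a^2)^2)"
proof -
  have a: "a \<noteq> 0" using w assms(2) by auto
  then have x: "x = of_int n / of_int a" using w assms(2) by (simp add: field_simps)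
  define A N :: rat where "A = of_int a" and "N = of_int n"
  have nz: "A \<noteq> 0" "N \<noteq> 0" using a w(2) by (simp_all add: A_def N_def)
  have e: "4*(N/A)*((N/A)^2+12*(N/A)-4) = 4*A*N*(N^2+12*A*N-4*A^2) / A^4"
      "((N/A)^2+4)^2 = (N^2+4*A^2)^2 / A^4"
    using nz by (simp_all add: field_simps power2_eq_square power4_eq_xxxx)
  have "1 / (((N/A)^2+4)^2 / (4*(N/A)*((N/A)^2+12*(N/A)-4))) =
     4*A*N*(N^2+12*A*N-4*A^2) / (N^2+4*A^2)^2" unfolding e using nz by simp
  then show ?thesis using double_E[OF assms(1,2)] unfolding x A_def N_def by auto
qed

text \<open>Each doubling multiplies \<open>1/x\<close> by exactly 4 up to odd factors, because the
  numerator of \<open>1/x\<close> is even and its denominator odd; so its 2-adic valuation is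
  \<open>2*(k+1)\<close>. Divisibility by 3 also persists: modulo 3 the point (1,3) has order two
  and these multiples reduce to infinity, which is why the orbit starts at the first
  doubling.\<close>

lemma doubling_orbit:
  "\<exists>x y m n. P_E [^]\<^bsub>G_E\<^esub> (2^Suc k :: nat) = Affine x y \<and> x \<noteq> 0 \<and> odd m \<and> odd n \<and> \<not> 3 dvd n \<and>
     1/x = of_int (4^Suc k*(3*m)) / of_int n"
proof (induction k)
  case 0
  interpret comm_group G_E by (rule comm_group_E)
  have "P_E \<uplus> P_E = Affine (25/36) (-395/216)" by (simp add: Let_def field_simps)
  then have "P_E [^]\<^bsub>G_E\<^esub> (2^Suc 0 :: nat) = Affine (25/36) (-395/216)" 
    by (simp add: numeral_2_eq_2)
  moreover have "odd (3::int)" "odd (25::int)" "\<not> 3 dvd (25::int)" "(25/36::rat) \<noteq> 0" by simp_all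
  moreover have "1/(25/36) = (of_int (4^Suc 0*(3*3)) / of_int 25 :: rat)" by simp
  ultimately show ?case by blast
next
  case (Suc k)
  interpret comm_group G_E by (rule comm_group_E)
  from Suc obtain x y m n where *: "P_E [^]\<^bsub>G_E\<^esub> (2^Suc k :: nat) = Affine x y" "x \<noteq> 0" "odd m" "odd n"
    "\<not> 3 dvd n" "1/x = of_int (4^Suc k*(3*m)) / of_int n" by blast
  define a where "a = 4^Suc k*(3*m)"
  have on: "on_E (Affine x y)" using nat_pow_closed[of P_E "2^Suc k"] *(1) by simp
  have n: "n \<noteq> 0" using *(4) by auto
  obtain x' y' where x': "Affine x y \<uplus> Affine x y = Affine x' y'"
     "1/x' = of_int (4*a*n*(n^2+12*a*n-4*a^2)) / of_int ((n^2+4*a^2)^2)"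
    using inverse_double[OF on *(2) *(6)[folded a_def] n] by blast
  have "P_E [^]\<^bsub>G_E\<^esub> (2^Suc (Suc k) :: nat) = P_E [^]\<^bsub>G_E\<^esub> (2^Suc k :: nat) \<otimes>\<^bsub>G_E\<^esub> P_E [^]\<^bsub>G_E\<^esub> (2^Suc k :: nat)"
    by (subst nat_pow_mult) (simp_all flip: mult_2)
  then have 1: "P_E [^]\<^bsub>G_E\<^esub> (2^Suc (Suc k) :: nat) = Affine x' y'" using x'(1) *(1) by (simp del: ec_add.simps)
  have a: "a \<noteq> 0" "even a" "3 dvd a" using *(3) by (auto simp: a_def)
  have o: "odd (n^2+12*a*n-4*a^2)" "odd ((n^2+4*a^2)^2)" using *(4) by simp_all
  have p3: "prime (3::int)" by simp
  have 3: "\<not> 3 dvd (n^2+4*a^2)^2"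
  proof
    assume "3 dvd (n^2+4*a^2)^2"
    then have "3 dvd n^2+4*a^2" using p3 prime_dvd_power by blast
    moreover have "3 dvd 4*a^2" using a(3) by (intro dvd_mult) (auto simp: power2_eq_square)
    ultimately have "3 dvd n^2" by (simp add: dvd_add_left_iff)
    then show False using p3 prime_dvd_power *(5) by blast
  qed
  define m' where "m' = m*n*(n^2+12*a*n-4*a^2)"
  have am: "4*a*n*(n^2+12*a*n-4*a^2) = 4^Suc (Suc k)*(3*m')" by (simp add: m'_def a_def)
  have 2: "1/x' = of_int (4^Suc (Suc k)*(3*m')) / of_int ((n^2+4*a^2)^2)"
    using x'(2) unfolding am .
  have m': "odd m'" using o *(3,4) by (simp add: m'_def)
  have "x' \<noteq> 0"
  proof
    assume "x' = 0"
    then have "4^Suc (Suc k)*(3*m') = 0 \<or> (n^2+4*a^2)^2 = 0"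
      using 2 unfolding divide_eq_0_iff[symmetric] by (metis div_by_0 divide_eq_0_iff of_int_eq_0_iff)
    moreover have "4^Suc (Suc k)*(3*m') \<noteq> 0" using m' by auto
    moreover have "(n^2+4*a^2)^2 \<noteq> 0" using o(2) by (metis even_zero)
    ultimately show False by blast
  qed
  then show ?case using 1 2 m' o(2) 3 by blast
qed

lemma doubling_orbit_inj: "inj (\<lambda>k. P_E [^]\<^bsub>G_E\<^esub> (2^Suc k :: nat))"
proof (rule injI)
  fix k l :: nat
  assume eq: "P_E [^]\<^bsub>G_E\<^esub> (2^Suc k :: nat) = P_E [^]\<^bsub>G_E\<^esub> (2^Suc l :: nat)"
  obtain x y m n where k: "P_E [^]\<^bsub>G_E\<^esub> (2^Suc k :: nat) = Affine x y" "odd m" "odd n"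
    "1/x = of_int (4^Suc k*(3*m)) / of_int n" using doubling_orbit by blast
  obtain x' y' m' n' where l: "P_E [^]\<^bsub>G_E\<^esub> (2^Suc l :: nat) = Affine x' y'" "odd m'" "odd n'"
    "1/x' = of_int (4^Suc l*(3*m')) / of_int n'" using doubling_orbit by blast
  have "of_int (4^Suc k*(3*m)) / of_int n = (of_int (4^Suc l*(3*m')) / of_int n' :: rat)"
    using eq k(1) l(1) unfolding k(4)[symmetric] l(4)[symmetric] by simp
  moreover have "n \<noteq> 0" "n' \<noteq> 0" using k l by auto
  ultimately have "of_int (4^Suc k*(3*m) * n') = (of_int (4^Suc l*(3*m') * n) :: rat)"
    by (simp add: frac_eq_eq)
  then have "4^Suc k*(3*m) * n' = 4^Suc l*(3*m') * n" by (simp only: of_int_eq_iff)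
  then have e: "4^k*(m*n') = 4^l*(m'*n)" by simp
  have "multiplicity 2 (4^j*a) = 2*j" if "odd a" for j and a :: int
  proof -
    have "(4::int)^j = 2^(2*j)" by (simp add: power_mult)
    moreover have "a \<noteq> 0" "multiplicity 2 a = 0" using that by (auto intro: not_dvd_imp_multiplicity_0)
    ultimately show ?thesis by (simp add: prime_elem_multiplicity_mult_distrib multiplicity_same_power')
  qed
  from this[of "m*n'" k] this[of "m'*n" l] show "k = l" using e k l by simp
qed

text \<open>An annihilating exponent would confine all multiples of \<open>P_E\<close> to finitely
  many residues, contrary to \<open>doubling_orbit_inj\<close>.\<close>

lemma infinite_order:
  assumes "P_E [^]\<^bsub>G_E\<^esub> (z::int) = Infinity" shows "z = 0"
proof (rule ccontr)
  interpret comm_group G_E by (rule comm_group_E)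
  have P: "P_E \<in> carrier G_E" by simp
  assume "z \<noteq> 0"
  have z: "P_E [^]\<^bsub>G_E\<^esub> (z * j) = \<one>\<^bsub>G_E\<^esub>" for j :: int
  proof -
    have "P_E [^]\<^bsub>G_E\<^esub> (z * j) = (P_E [^]\<^bsub>G_E\<^esub> z) [^]\<^bsub>G_E\<^esub> j" using int_pow_pow[OF P] by simp
    also have "\<dots> = \<one>\<^bsub>G_E\<^esub>" using assms int_pow_one by (metis one_E)
    finally show ?thesis .
  qed
  have "P_E [^]\<^bsub>G_E\<^esub> (n :: nat) \<in> (\<lambda>i::int. P_E [^]\<^bsub>G_E\<^esub> i) ` {0..\<bar>z\<bar>}" for n
  proof -
    define r where "r = int n mod \<bar>z\<bar>"
    obtain j where "int n = r + z * j"
    proof -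
      have "int n = r + \<bar>z\<bar> * (int n div \<bar>z\<bar>)" by (simp add: r_def)
      then show ?thesis using that[of "sgn z * (int n div \<bar>z\<bar>)"] by (simp add: abs_sgn ac_simps)
    qed
    then have "P_E [^]\<^bsub>G_E\<^esub> int n = P_E [^]\<^bsub>G_E\<^esub> r"
      using z int_pow_mult[OF P, of r "z*j"] int_pow_closed[OF P] by (metis r_one)
    moreover have "r \<in> {0..\<bar>z\<bar>}" using \<open>z \<noteq> 0\<close> pos_mod_bound[of "\<bar>z\<bar>" "int n"] pos_mod_sign[of "\<bar>z\<bar>" "int n"] unfolding r_def
      by (intro atLeastAtMost_iff[THEN iffD2]) linarith
    ultimately show ?thesis by (metis imageI int_pow_int)
  qed
  then have "range (\<lambda>k. P_E [^]\<^bsub>G_E\<^esub> (2^Suc k :: nat)) \<subseteq> (\<lambda>i::int. P_E [^]\<^bsub>G_E\<^esub> i) ` {0..\<bar>z\<bar>}" by blast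
  then have "finite (range (\<lambda>k. P_E [^]\<^bsub>G_E\<^esub> (2^Suc k :: nat)))" by (rule finite_subset) simp
  then show False using range_inj_infinite[OF doubling_orbit_inj] by blast
qed

text \<open>Two elements with \<open>x^n = g^k\<close> and \<open>y^m = g^l\<close> satisfy the
  relation with exponents \<open>n*l\<close> and \<open>-m*k\<close>. Independence makes
  \<open>k\<close> and \<open>l\<close> zero, and then \<open>x^n\<close> is already
  trivial.\<close>

lemma (in comm_group) card_independent_le_1:
  assumes dep: "\<And>x. x \<in> carrier G \<Longrightarrow> \<exists>(n::int) (k::int). n \<noteq> 0 \<and> x [^] n = g [^] k" and g: "g \<in> carrier G"
    and S: "int_independent G S"
  shows "card S \<le> 1"
proof (rule ccontr)
  assume "\<not> card S \<le> 1"
  have fin: "finite S" and sub: "S \<subseteq> carrier G" using S by (auto simp: int_independent_def)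
  then obtain x y where xy: "x \<in> S" "y \<in> S" "x \<noteq> y"
    using \<open>\<not> card S \<le> 1\<close> by (metis One_nat_def card_le_Suc0_iff_eq)
  have c: "x \<in> carrier G" "y \<in> carrier G" using xy sub by auto
  obtain n k where n: "n \<noteq> 0" "x [^] (n::int) = g [^] (k::int)" using dep c by blast
  obtain m l where m: "m \<noteq> 0" "y [^] (m::int) = g [^] (l::int)" using dep c by blast
  have indep: "a = 0 \<and> b = 0" if ab: "x [^] a \<otimes> y [^] b = \<one>" for a b :: int
  proof -
    \<comment> \<open>A relation between \<open>x\<close> and \<open>y\<close> is extended by zero
      exponents to one over all of \<open>S\<close>.\<close>
    define f where "f = (\<lambda>s. if s = x then a else if s = y then b else 0)"
    define T where "T = S - {x, y}"
    have ST: "S = insert x (insert y T)" "x \<notin> insert y T" "y \<notin> T" "finite T" "T \<subseteq> carrier G"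
      using xy fin sub by (auto simp: T_def)
    have "finprod G (\<lambda>s. s [^] f s) T = \<one>"
      by (rule finprod_one_eqI) (auto simp: T_def f_def)
    moreover have "(\<lambda>s. s [^] f s) \<in> insert y T \<rightarrow> carrier G" "(\<lambda>s. s [^] f s) \<in> T \<rightarrow> carrier G"
      using ST(5) c by auto
    ultimately have "finprod G (\<lambda>s. s [^] f s) S = x [^] f x \<otimes> y [^] f y"
      unfolding ST(1) using ST(2-4) c by simp
    also have "\<dots> = \<one>" using ab xy(3) by (simp add: f_def)
    finally have "\<forall>s\<in>S. f s = 0" using S by (simp add: int_independent_def)
    then have "f x = 0" "f y = 0" using xy by auto
    then show ?thesis using xy(3) by (simp add: f_def)
  qed
  have "x [^] (n*l) = g [^] (k*l)" using n c g by (metis int_pow_pow)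
  moreover have "y [^] (m*(-k)) = g [^] (l*(-k))" using m c g by (metis int_pow_pow)
  ultimately have "x [^] (n*l) \<otimes> y [^] (m*(-k)) = g [^] (k*l + l*(-k))" using g by (simp only: int_pow_mult)
  then have "x [^] (n*l) \<otimes> y [^] (m*(-k)) = \<one>" by simp
  then have "n*l = 0 \<and> m*(-k) = 0" by (rule indep)
  then have "l = 0" "k = 0" using n m by auto
  then have "x [^] n \<otimes> y [^] (0::int) = \<one>" using n by simp
  then have "n = 0" using indep by blast
  then show False using n by simp
qed

lemma (in comm_group) int_independent_singleton:
  assumes "x \<in> carrier G" "\<And>n::int. x [^] n = \<one> \<Longrightarrow> n = 0"
  shows "int_independent G {x}"
  using assms by (simp add: int_independent_def)

lemma rank_E: "group_rank G_E = 1"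
proof -
  interpret comm_group G_E by (rule comm_group_E)
  have "int_independent G_E {P_E}"
    by (rule int_independent_singleton) (use infinite_order in simp_all)
  then have "enat (card {P_E}) \<le> group_rank G_E" unfolding group_rank_def by (intro SUP_upper) simp
  moreover have "group_rank G_E \<le> 1"
    unfolding group_rank_def
  proof (intro SUP_least)
    fix S assume "S \<in> {S. int_independent G_E S}"
    then have "card S \<le> 1" using card_independent_le_1[of P_E S] dependent_E by simp
    then show "enat (card S) \<le> 1" by (simp add: one_enat_def)
  qed
  ultimately show ?thesis by (simp add: one_enat_def antisym)
qed

section \<open>Even sextics with two cubic factors\<close>

lemma trinomial5_eq: "trinomial5 A B = [:B, A, 0, 0, 0, 1:]"
  by (simp add: trinomial5_def monom_Suc numeral_eq_Suc monom_0)

lemma trinomial10_eq: "trinomial10 A B = [:B, 0, A, 0, 0, 0, 0, 0, 0, 0, 1:]"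
  by (simp add: trinomial10_def monom_Suc numeral_eq_Suc monom_0)

text \<open>The cubic cofactor of the quadratic factor in \<open>trinomial5_factor\<close>, with
  \<open>x\<close> replaced by \<open>x^2\<close>.\<close>

definition even_sextic :: "rat \<Rightarrow> rat \<Rightarrow> rat poly" where
  "even_sextic u v = [:2*u*v-u^3, 0, u^2-v, 0, -u, 0, 1:]"

lemma trinomial5_factor:
  "trinomial5 (3*u^2*v-u^4-v^2) (2*u*v^2-u^3*v) = [:v, u, 1:] * [:2*u*v-u^3, u^2-v, -u, 1:]"
  by (simp add: trinomial5_eq power2_eq_square power3_eq_cube power4_eq_xxxx algebra_simps)

text \<open>Subtracting the explicit multiple leaves a polynomial of degree at most 1 divisible by a
  quadratic, hence zero.\<close>

lemma quadratic_factor_iff: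
  "quadratic_factor (A, B, u, v) \<longleftrightarrow> A = 3*u^2*v-u^4-v^2 \<and> B = 2*u*v^2-u^3*v"
proof
  assume "quadratic_factor (A, B, u, v)"
  then have "[:v, u, 1:] dvd trinomial5 A B - trinomial5 (3*u^2*v-u^4-v^2) (2*u*v^2-u^3*v)"
    unfolding trinomial5_factor by (intro dvd_diff dvd_triv_left) (simp add: quadratic_factor_def)
  then have d: "[:v, u, 1:] dvd [:B - (2*u*v^2-u^3*v), A - (3*u^2*v-u^4-v^2):]"
    by (simp add: trinomial5_eq)
  have "[:B - (2*u*v^2-u^3*v), A - (3*u^2*v-u^4-v^2):] = 0"
  proof (rule ccontr)
    assume "[:B - (2*u*v^2-u^3*v), A - (3*u^2*v-u^4-v^2):] \<noteq> 0"
    from dvd_imp_degree_le[OF d this] show False by (simp split: if_splits)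
  qed
  then show "A = 3*u^2*v-u^4-v^2 \<and> B = 2*u*v^2-u^3*v" by simp
next
  assume "A = 3*u^2*v-u^4-v^2 \<and> B = 2*u*v^2-u^3*v"
  then have "trinomial5 A B = [:v, u, 1:] * [:2*u*v-u^3, u^2-v, -u, 1:]" using trinomial5_factor by simp
  then show "quadratic_factor (A, B, u, v)" unfolding quadratic_factor_def prod.case by (metis dvd_triv_left)
qed

lemma sextic_eq:
  assumes "quadratic_factor (A, B, u, v)" shows "sextic (A, B, u, v) = even_sextic u v"
proof -
  have "trinomial10 A B = [:v, 0, u, 0, 1:] * even_sextic u v"
    using assms
    by (simp add: quadratic_factor_iff trinomial10_eq even_sextic_def power2_eq_square power3_eq_cube power4_eq_xxxx algebra_simps)
  moreover have "[:v, 0, u, 0, 1:] \<noteq> 0" by simp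
  ultimately show ?thesis by (simp add: sextic_def del: mult_pCons_left)
qed

section \<open>Monic cubics over the rationals\<close>

abbreviation cubic :: "rat \<Rightarrow> rat \<Rightarrow> rat \<Rightarrow> rat poly" where
  "cubic a b c \<equiv> [:c, b, a, 1:]"

lemma irreducible_cubic_iff:
  "irreducible (cubic a b c) \<longleftrightarrow> (\<forall>z. z^3 + a*z^2 + b*z + c \<noteq> 0)"
proof -
  have root: "poly (cubic a b c) z = z^3 + a*z^2 + b*z + c" for z
    by (simp add: power2_eq_square power3_eq_cube algebra_simps)
  show ?thesis
  proof
    assume irr: "irreducible (cubic a b c)"
    show "\<forall>z. z^3 + a*z^2 + b*z + c \<noteq> 0"
    proof (intro allI notI)
      fix z assume "z^3 + a*z^2 + b*z + c = 0"
      then have "[:-z, 1:] dvd cubic a b c" using root by (simp only: poly_eq_0_iff_dvd[symmetric])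
      then obtain q where q: "cubic a b c = [:-z, 1:] * q" ..
      have "degree (cubic a b c) = 1 + degree q"
        unfolding q using q by (subst degree_mult_eq) auto
      then have "degree q = 2" by simp
      moreover from this have "q \<noteq> 0" by auto
      ultimately have "\<not> [:-z, 1:] dvd 1" "\<not> q dvd 1" by (auto simp: is_unit_iff_degree)
      then show False using irreducibleD[OF irr q] by blast
    qed
  next
    assume nr: "\<forall>z. z^3 + a*z^2 + b*z + c \<noteq> 0"
    have deg1: "False" if "p dvd cubic a b c" "degree p = 1" for p
    proof -
      define s t where "s = coeff p 0" and "t = coeff p 1"
      have p: "p = [:s, t:]"
        by (rule poly_eqI) (use that(2) in \<open>auto simp: s_def t_def coeff_pCons coeff_eq_0 split: nat.split\<close>)
      then have "t \<noteq> 0" using that(2) by auto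
      then have "poly p (-s/t) = 0" using p by simp
      then have "poly (cubic a b c) (-s/t) = 0" using that(1) by (metis dvdE mult_zero_left poly_mult)
      then show False using nr root by metis
    qed
    show "irreducible (cubic a b c)"
    proof (rule irreducibleI)
      fix p q assume pq: "cubic a b c = p * q"
      then have nz: "p \<noteq> 0" "q \<noteq> 0" by auto
      have "degree (cubic a b c) = degree p + degree q" unfolding pq using nz by (rule degree_mult_eq)
      then have "degree p + degree q = 3" by simp
      moreover have "degree p \<noteq> 1" "degree q \<noteq> 1" using deg1 pq by (metis dvd_triv_left dvd_triv_right)+
      ultimately have "degree p = 0 \<or> degree q = 0" by linarith
      then show "p dvd 1 \<or> q dvd 1" using nz by (simp add: is_unit_iff_degree)
    qed (auto simp: is_unit_iff_degree)
  qed
qed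

text \<open>For \<open>p = cubic a b c\<close>, the cubic \<open>cubic (-a) b (-c)\<close> is
  -p(-x).\<close>

lemma irreducible_cubic_flip:
  assumes "irreducible (cubic a b c)" shows "irreducible (cubic (-a) b (-c))"
  unfolding irreducible_cubic_iff
proof
  fix z
  have "(-z)^3 + a*(-z)^2 + b*(-z) + c \<noteq> 0" using assms unfolding irreducible_cubic_iff by blast
  then show "z^3 + (-a)*z^2 + b*z + (-c) \<noteq> 0" by (simp add: algebra_simps)
qed

lemma irreducible_cubic_scale:
  assumes "irreducible (cubic a b c)" "l \<noteq> 0" shows "irreducible (cubic (l*a) (l^2*b) (l^3*c))"
  unfolding irreducible_cubic_iff
proof
  fix z
  have "(z/l)^3 + a*(z/l)^2 + b*(z/l) + c \<noteq> 0" using assms(1) unfolding irreducible_cubic_iff by blast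
  then have "l^3 * ((z/l)^3 + a*(z/l)^2 + b*(z/l) + c) \<noteq> 0" using assms(2) by simp
  also have "l^3 * ((z/l)^3 + a*(z/l)^2 + b*(z/l) + c) = z^3 + (l*a)*z^2 + (l^2*b)*z + l^3*c"
    using assms(2) by (simp add: field_simps power2_eq_square power3_eq_cube)
  finally show "z^3 + (l*a)*z^2 + (l^2*b)*z + l^3*c \<noteq> 0" .
qed

lemma cubic_mult_flip:
  "cubic a b c * cubic (-a) b (-c) = [:-(c^2), 0, b^2-2*a*c, 0, 2*b-a^2, 0, 1:]"
  by (simp add: power2_eq_square algebra_simps)

lemma even_sextic_eq_iff:
  "even_sextic u v = cubic a b c * cubic (-a) b (-c) \<longleftrightarrow>
     u = a^2-2*b \<and> v = u^2-b^2+2*a*c \<and> 2*u*v-u^3 = -(c^2)"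
  unfolding cubic_mult_flip even_sextic_def by (auto simp: algebra_simps)

lemma monic_cubic_dvd_eq:
  assumes "cubic a b c dvd cubic a' b' c'" shows "a = a' \<and> b = b' \<and> c = c'"
proof -
  obtain q where q: "cubic a' b' c' = cubic a b c * q" using assms ..
  then have "q \<noteq> 0" by auto
  then have "degree (cubic a' b' c') = degree (cubic a b c) + degree q"
    unfolding q by (intro degree_mult_eq) auto
  then have "degree q = 0" by simp
  then obtain k where "q = [:k:]" by (rule degree_eq_zeroE)
  then show ?thesis using q by simp
qed

text \<open>An irreducible cubic divides one of the two monic cubics on the other side and so equals
  it. Thus the sextic determines \<open>(a, b, c)\<close> up to the flip.\<close>

lemma cubic_flip_unique:
  assumes irr: "irreducible (cubic a b c)"
    and eq: "cubic a b c * cubic (-a) b (-c) = cubic a' b' c' * cubic (-a') b' (-c')"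
  shows "(a', b', c') = (a, b, c) \<or> (a', b', c') = (-a, b, -c)"
proof -
  have "prime_elem (cubic a b c)" using irr by (rule field_poly_irreducible_imp_prime)
  moreover have "cubic a b c dvd cubic a' b' c' * cubic (-a') b' (-c')" unfolding eq[symmetric] by (rule dvd_triv_left)
  ultimately have "cubic a b c dvd cubic a' b' c' \<or> cubic a b c dvd cubic (-a') b' (-c')"
    by (rule prime_elem_dvd_multD)
  then show ?thesis using monic_cubic_dvd_eq by fastforce
qed

lemma degree_3_cubic:
  assumes "degree p = 3" obtains k a b c where "k \<noteq> 0" "p = smult k (cubic a b c)"
proof -
  define k where "k = coeff p 3"
  have k: "k \<noteq> 0" using assms by (metis k_def degree_0 leading_coeff_0_iff zero_neq_numeral)
  have "p = smult k (cubic (coeff p 2 / k) (coeff p 1 / k) (coeff p 0 / k))"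
  proof (rule poly_eqI)
    fix n :: nat
    consider "n = 0" | "n = 1" | "n = 2" | "n = 3" | "n > 3" by linarith
    then show "coeff p n = coeff (smult k (cubic (coeff p 2 / k) (coeff p 1 / k) (coeff p 0 / k))) n"
    proof cases
      case 5 then show ?thesis using assms by (simp add: coeff_eq_0)
    qed (use k in \<open>simp_all add: k_def numeral_eq_Suc\<close>)
  qed
  then show thesis using that k by blast
qed

lemma type33_iff:
  "(A, B, u, v) \<in> type33_quadruples \<longleftrightarrow> A * B \<noteq> 0 \<and> quadratic_factor (A, B, u, v) \<and>
     (\<exists>a b c. irreducible (cubic a b c) \<and> even_sextic u v = cubic a b c * cubic (-a) b (-c))"
proof
  assume "(A, B, u, v) \<in> type33_quadruples"
  then have h: "A * B \<noteq> 0" "quadratic_factor (A, B, u, v)" "has_reducibility_type (even_sextic u v) [3, 3]"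
    by (auto simp: type33_quadruples_def sextic_eq)
  then obtain p q where pq: "irreducible p" "irreducible q" "even_sextic u v = p * q"
      and deg: "degree p = 3" "degree q = 3"
    by (auto simp: has_reducibility_type_def)
  obtain k a b c where p: "k \<noteq> 0" "p = smult k (cubic a b c)" by (rule degree_3_cubic[OF deg(1)])
  obtain k' a' b' c' where q: "k' \<noteq> 0" "q = smult k' (cubic a' b' c')" by (rule degree_3_cubic[OF deg(2)])
  \<comment> \<open>The irreducible factors need not be monic; comparing leading coefficients shows
    that their constants cancel.\<close>
  have e: "even_sextic u v = smult (k*k') (cubic a b c * cubic a' b' c')"
    unfolding pq(3) p q by (simp only: mult_smult_left mult_smult_right smult_smult mult.commute[of k' k])
  then have "coeff (even_sextic u v) 6 = k * k'" by (simp add: numeral_eq_Suc)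
  then have "k*k' = 1" by (simp add: even_sextic_def numeral_eq_Suc)
  then have e: "even_sextic u v = cubic a b c * cubic a' b' c'" using e by (simp only: smult_1_left)
  have irr: "irreducible (cubic a b c)" 
  proof -
    have "p = [:k:] * cubic a b c" using p by simp
    then show ?thesis using pq(1) irreducible_mult_unit_left[of "[:k:]" "cubic a b c"] p(1) by (simp add: is_unit_iff_degree del: mult_pCons_left)
  qed
  have "coeff (even_sextic u v) n = 0" if "odd n" for n
  proof (cases "n \<le> 6")
    case True
    then have "n = 1 \<or> n = 3 \<or> n = 5" using that by presburger
    then show ?thesis by (auto simp: even_sextic_def numeral_eq_Suc)
  qed (simp add: even_sextic_def coeff_eq_0)
  have "even_sextic u v = pcompose (even_sextic u v) [:0, -1:]"
    by (simp add: even_sextic_def pcompose_pCons)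
  also have "\<dots> = pcompose (cubic a b c) [:0, -1:] * pcompose (cubic a' b' c') [:0, -1:]"
    unfolding e by (rule pcompose_mult)
  also have "pcompose (cubic a b c) [:0, -1:] = - cubic (-a) b (-c)" by (simp add: pcompose_pCons)
  finally have "cubic (-a) b (-c) dvd cubic a b c * cubic a' b' c'"
    unfolding e by (metis dvd_triv_left dvd_minus_iff minus_dvd_iff)
  moreover have "prime_elem (cubic (-a) b (-c))"
    using irreducible_cubic_flip[OF irr] by (rule field_poly_irreducible_imp_prime)
  ultimately consider "cubic (-a) b (-c) dvd cubic a b c" | "cubic (-a) b (-c) dvd cubic a' b' c'"
    using prime_elem_dvd_multD by blast
  then have "cubic a' b' c' = cubic (-a) b (-c)"
  proof cases
    case 1
    \<comment> \<open>If the cubic equals its own flip, its constant term vanishes and 0 is a root,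
      contradicting irreducibility.\<close>
    then have "c = 0" using monic_cubic_dvd_eq by fastforce
    then have "(0::rat)^3 + a*0^2 + b*0 + c = 0" by simp
    then show ?thesis using irr unfolding irreducible_cubic_iff by blast
  next
    case 2 then show ?thesis using monic_cubic_dvd_eq by fastforce
  qed
  then show "A * B \<noteq> 0 \<and> quadratic_factor (A, B, u, v) \<and>
     (\<exists>a b c. irreducible (cubic a b c) \<and> even_sextic u v = cubic a b c * cubic (-a) b (-c))"
    using h irr e by metis
next
  assume h: "A * B \<noteq> 0 \<and> quadratic_factor (A, B, u, v) \<and>
     (\<exists>a b c. irreducible (cubic a b c) \<and> even_sextic u v = cubic a b c * cubic (-a) b (-c))"
  then obtain a b c where abc: "irreducible (cubic a b c)" "even_sextic u v = cubic a b c * cubic (-a) b (-c)" by blast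
  have "lead_coeff (even_sextic u v) = 1" by (simp add: even_sextic_def)
  moreover have "\<exists>ps. (\<forall>p\<in>set ps. irreducible p) \<and> even_sextic u v = prod_list ps \<and> map degree ps = [3, 3]"
    by (rule exI[of _ "[cubic a b c, cubic (-a) b (-c)]"])
       (use abc irreducible_cubic_flip[OF abc(1)] in \<open>simp del: mult_pCons_left\<close>)
  ultimately show "(A, B, u, v) \<in> type33_quadruples"
    using h by (simp add: type33_quadruples_def sextic_eq has_reducibility_type_def)
qed

section \<open>Reduction modulo 3\<close>

text \<open>Reduction modulo 3 on rationals with denominator prime to 3; a rational with 3 in its
  reduced denominator is congruent to nothing.\<close>

definition cong3 :: "rat \<Rightarrow> int \<Rightarrow> bool" where
  "cong3 x i \<longleftrightarrow> (\<exists>m n. \<not> 3 dvd n \<and> x = of_int m / of_int n \<and> 3 dvd m - i*n)"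

lemma prime_3: "prime (3::int)" by simp

lemma not_3_dvd_mult: "\<not> 3 dvd a \<Longrightarrow> \<not> 3 dvd b \<Longrightarrow> \<not> 3 dvd a * (b::int)"
  using prime_dvd_mult_iff[OF prime_3] by blast

lemma cong3_of_int: "cong3 (of_int i) i"
  unfolding cong3_def by (intro exI[of _ i] exI[of _ 1]) simp

lemma cong3_numeral: "cong3 (numeral k) (numeral k)" and cong3_1: "cong3 1 1" and cong3_0: "cong3 0 0"
  using cong3_of_int[of "numeral k"] cong3_of_int[of 1] cong3_of_int[of 0] by simp_all

lemma cong3_add: assumes "cong3 x i" "cong3 y j" shows "cong3 (x + y) (i + j)"
proof -
  obtain m n where x: "\<not> 3 dvd n" "x = of_int m / of_int n" "3 dvd m - i*n" using assms(1) cong3_def by blast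
  obtain r s where y: "\<not> 3 dvd s" "y = of_int r / of_int s" "3 dvd r - j*s" using assms(2) cong3_def by blast
  have nz: "n \<noteq> 0" "s \<noteq> 0" using x y by auto
  have "x + y = of_int (m*s + r*n) / of_int (n*s)" using x y nz by (simp add: field_simps)
  moreover have "m*s + r*n - (i+j)*(n*s) = (m - i*n)*s + (r - j*s)*n" by (simp add: algebra_simps)
  then have "3 dvd m*s + r*n - (i+j)*(n*s)" using x(3) y(3) by (simp only: dvd_add dvd_mult2)
  ultimately show ?thesis using not_3_dvd_mult x(1) y(1) unfolding cong3_def by blast
qed

lemma cong3_mult: assumes "cong3 x i" "cong3 y j" shows "cong3 (x * y) (i * j)"
proof -
  obtain m n where x: "\<not> 3 dvd n" "x = of_int m / of_int n" "3 dvd m - i*n" using assms(1) cong3_def by blast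
  obtain r s where y: "\<not> 3 dvd s" "y = of_int r / of_int s" "3 dvd r - j*s" using assms(2) cong3_def by blast
  have "x * y = of_int (m*r) / of_int (n*s)" using x y by simp
  moreover have "m*r - (i*j)*(n*s) = (m - i*n)*r + (r - j*s)*(i*n)" by (simp add: algebra_simps)
  then have "3 dvd m*r - (i*j)*(n*s)" using x(3) y(3) by (simp only: dvd_add dvd_mult2)
  ultimately show ?thesis using not_3_dvd_mult x(1) y(1) unfolding cong3_def by blast
qed

lemma cong3_uminus: "cong3 x i \<Longrightarrow> cong3 (- x) (- i)"
  using cong3_mult[OF cong3_of_int[of "-1"], of x i] by simp

lemma cong3_diff: "cong3 x i \<Longrightarrow> cong3 y j \<Longrightarrow> cong3 (x - y) (i - j)"
  using cong3_add[OF _ cong3_uminus, of x i y j] by simp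

lemma cong3_power: "cong3 x i \<Longrightarrow> cong3 (x ^ k) (i ^ k)"
  by (induction k) (auto intro: cong3_mult cong3_1)

lemmas cong3_intros = cong3_add cong3_mult cong3_diff cong3_uminus cong3_power cong3_numeral cong3_1 cong3_0

lemma cong3_cong: "cong3 x i \<Longrightarrow> 3 dvd i - j \<Longrightarrow> cong3 x j"
proof -
  assume "cong3 x i" and d: "3 dvd i - j"
  then obtain m n where x: "\<not> 3 dvd n" "x = of_int m / of_int n" "3 dvd m - i*n" using cong3_def by blast
  have "m - j*n = (m - i*n) + (i - j)*n" by (simp add: algebra_simps)
  then have "3 dvd m - j*n" using x(3) d by (simp only: dvd_add dvd_mult2)
  then show ?thesis using x unfolding cong3_def by blast
qed

lemma cong3_0_dvd: assumes "cong3 0 i" shows "3 dvd i"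
proof -
  obtain m n where x: "\<not> 3 dvd n" "0 = of_int m / (of_int n :: rat)" "3 dvd m - i*n" using assms cong3_def by blast
  then have "m = 0" by auto
  then have "3 dvd i * n" using x(3) by simp
  then show ?thesis using x(1) prime_dvd_mult_iff[OF prime_3] by blast
qed

lemma cong3_nonzero: "cong3 x i \<Longrightarrow> \<not> 3 dvd i \<Longrightarrow> x \<noteq> 0"
  using cong3_0_dvd by blast

text \<open>The four cases are the points of the projective line over the field with three elements,
  the last being infinity.\<close>

lemma cong3_cases: "cong3 x 0 \<or> cong3 x 1 \<or> cong3 x 2 \<or> x \<noteq> 0 \<and> cong3 (1/x) 0"
proof -
  obtain p q where "quotient_of x = (p, q)" by fastforce
  then have pq: "x = of_int p / of_int q" "q > 0" "coprime p q"
    by (simp_all add: quotient_of_div quotient_of_denom_pos quotient_of_coprime)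
  show ?thesis
  proof (cases "3 dvd q")
    case True
    then have p: "\<not> 3 dvd p" using pq(3) by (meson coprime_common_divisor prime_3 not_prime_unit)
    then have "x \<noteq> 0" using pq by auto
    moreover have "cong3 (1/x) 0" unfolding cong3_def using True p pq by (intro exI[of _ q] exI[of _ p]) simp
    ultimately show ?thesis by blast
  next
    case False
    then have "3 dvd p - 0*q \<or> 3 dvd p - 1*q \<or> 3 dvd p - 2*q" by presburger
    then show ?thesis using False pq(1) unfolding cong3_def by blast
  qed
qed

lemma cong3_inverse: assumes "cong3 x 1" shows "cong3 (1/x) 1"
proof -
  obtain m n where x: "\<not> 3 dvd n" "x = of_int m / of_int n" "3 dvd m - 1*n" using assms cong3_def by blast
  then have "\<not> 3 dvd m" "3 dvd n - 1*m" by presburger+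
  moreover have "1/x = of_int n / of_int m" using x by simp
  ultimately show ?thesis unfolding cong3_def by blast
qed

lemma cong3_square_0: assumes "cong3 (x^2) 0" shows "cong3 x 0"
proof -
  have i: "3 dvd i^2" if "cong3 x i" for i
    using cong3_0_dvd[of "i^2"] cong3_diff[OF cong3_power[OF that, of 2] assms] by simp
  have "\<not> (x \<noteq> 0 \<and> cong3 (1/x) 0)"
  proof
    assume h: "x \<noteq> 0 \<and> cong3 (1/x) 0"
    then have "cong3 (x^2 * (1/x)^2) (0 * 0^2)" using cong3_mult[OF assms cong3_power[of "1/x" 0 2]] by blast
    from cong3_diff[OF cong3_1 this] have "cong3 (1 - x^2 * (1/x)^2) (1 - 0 * 0^2)" .
    then have "cong3 0 1" using h by (simp add: power_divide)
    then show False using cong3_0_dvd by fastforce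
  qed
  then show ?thesis using cong3_cases[of x] i[of 1] i[of 2] by auto
qed

text \<open>Modulo 3 the cubic is \<open>z^3 + z^2 + z + 2\<close>, which has no zero among 0, 1, 2.
  If 3 divides the denominator of \<open>z\<close>, the reversed polynomial at \<open>1/z\<close> is
  congruent to 1.\<close>

lemma cong3_no_root:
  assumes "cong3 a 1" "cong3 b 1" "cong3 c 2" shows "z^3 + a*z^2 + b*z + c \<noteq> 0"
proof -
  have 1: ?thesis if "cong3 z i" "\<not> 3 dvd i^3 + 1*i^2 + 1*i + 2" for i
  proof -
    have "cong3 (z^3 + a*z^2 + b*z + c) (i^3 + 1*i^2 + 1*i + 2)" by (intro cong3_intros assms that)
    then show ?thesis using that(2) cong3_nonzero by blast
  qed
  have 2: ?thesis if "z \<noteq> 0" "cong3 (1/z) 0"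
  proof -
    have "cong3 (1 + a*(1/z) + b*(1/z)^2 + c*(1/z)^3) (1 + 1*0 + 1*0^2 + 2*0^3)" by (intro cong3_intros assms that)
    then have "1 + a*(1/z) + b*(1/z)^2 + c*(1/z)^3 \<noteq> 0" using cong3_nonzero by fastforce
    moreover have "z^3 + a*z^2 + b*z + c = z^3 * (1 + a*(1/z) + b*(1/z)^2 + c*(1/z)^3)"
      using that(1) by (simp add: field_simps power2_eq_square power3_eq_cube)
    ultimately show ?thesis using that(1) by simp
  qed
  show ?thesis using cong3_cases[of z] 1[of 0] 1[of 1] 1[of 2] 2 by auto
qed

section \<open>The parametrization\<close>

text \<open>Each scaling class is normalized by \<open>u = 2a\<close>, and \<open>a = X\<close>.
  Then \<open>factor_quad\<close> and \<open>factor_const\<close> are the coefficients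
  \<open>b\<close> and \<open>c\<close> of the cubic factor, obtained from
  \<open>u = a^2 - 2b\<close> and from solving \<open>Y = (c + 4X^2)/X\<close>.\<close>

definition factor_quad :: "rat \<Rightarrow> rat \<Rightarrow> rat" where "factor_quad X Y = X^2/2 - X"
definition factor_const :: "rat \<Rightarrow> rat \<Rightarrow> rat" where "factor_const X Y = X*Y - 4*X^2"
definition param_v :: "rat \<Rightarrow> rat \<Rightarrow> rat" where
  "param_v X Y = (2*X)^2 - (factor_quad X Y)^2 + 2*X*factor_const X Y"

definition quad_of_uv :: "rat \<Rightarrow> rat \<Rightarrow> quadruple" where
  "quad_of_uv u v = (3*u^2*v - u^4 - v^2, 2*u*v^2 - u^3*v, u, v)"

definition param :: "rat \<times> rat \<Rightarrow> quadruple" where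
  "param = (\<lambda>(X, Y). quad_of_uv (2*X) (param_v X Y))"

lemma quadratic_factor_quad_of_uv [simp]: "quadratic_factor (quad_of_uv u v)"
  by (simp add: quad_of_uv_def quadratic_factor_iff)

lemma quadratic_factor_imp_quad_of_uv: "quadratic_factor (A, B, u, v) \<Longrightarrow> (A, B, u, v) = quad_of_uv u v"
  by (simp add: quad_of_uv_def quadratic_factor_iff)

lemma sextic_quad_of_uv: "sextic (quad_of_uv u v) = even_sextic u v"
  using sextic_eq quadratic_factor_quad_of_uv by (metis quad_of_uv_def)

definition C_E :: "(rat \<times> rat) set" where
  "C_E = {(X, Y). Y ^ 2 = X * (X ^ 2 + 12 * X - 4)}"

lemma param_factorization:
  assumes "(X, Y) \<in> C_E"
  shows "even_sextic (2*X) (param_v X Y) =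
    cubic X (factor_quad X Y) (factor_const X Y) * cubic (-X) (factor_quad X Y) (- factor_const X Y)"
proof -
  define b c v where "b = factor_quad X Y" and "c = factor_const X Y" and "v = param_v X Y"
  have Y: "Y^2 = X * (X^2 + 12*X - 4)" using assms by (simp add: C_E_def)
  have b: "2*b = X^2 - 2*X" by (simp add: b_def factor_quad_def)
  have c: "c = X*Y - 4*X^2" by (simp add: c_def factor_const_def)
  have v: "v = (2*X)^2 - b^2 + 2*X*c" by (simp add: v_def param_v_def b_def c_def)
  have "2*X = X^2 - 2*b" using b by simp
  \<comment> \<open>The last condition on the coefficients is the curve equation. The factor 4
    clears the denominators that come from \<open>b\<close>, of which only \<open>2*b\<close> is
    polynomial.\<close>
  moreover have "4*(2*(2*X)*v - (2*X)^3) = 4*(-(c^2))" using Y b c v by algebra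
  then have "2*(2*X)*v - (2*X)^3 = -(c^2)" by simp
  ultimately show ?thesis using v unfolding even_sextic_eq_iff b_def c_def v_def by simp
qed

lemma type33_quad_of_uv_iff:
  "quad_of_uv u v \<in> type33_quadruples \<longleftrightarrow> (3*u^2*v - u^4 - v^2) * (2*u*v^2 - u^3*v) \<noteq> 0 \<and>
     (\<exists>a b c. irreducible (cubic a b c) \<and> even_sextic u v = cubic a b c * cubic (-a) b (-c))"
  using type33_iff quadratic_factor_quad_of_uv unfolding quad_of_uv_def by blast

lemma type33_factor_irreducible:
  assumes "quad_of_uv u v \<in> type33_quadruples" "even_sextic u v = cubic a b c * cubic (-a) b (-c)"
  shows "irreducible (cubic a b c)"
proof -
  obtain a' b' c' where irr: "irreducible (cubic a' b' c')" "even_sextic u v = cubic a' b' c' * cubic (-a') b' (-c')"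
    using assms(1) type33_quad_of_uv_iff by blast
  then have "(a, b, c) = (a', b', c') \<or> (a, b, c) = (-a', b', -c')"
    using cubic_flip_unique[OF irr(1)] assms(2) by metis
  then show ?thesis using irr(1) irreducible_cubic_flip[OF irr(1)] by auto
qed

section \<open>Behaviour under scaling\<close>

lemma even_sextic_scale:
  assumes "even_sextic u v = cubic a b c * cubic (-a) b (-c)"
  shows "even_sextic (l^2*u) (l^4*v) = cubic (l*a) (l^2*b) (l^3*c) * cubic (-(l*a)) (l^2*b) (-(l^3*c))"
proof -
  have "u = a^2-2*b" "v = u^2-b^2+2*a*c" "2*u*v-u^3 = -(c^2)"
    using assms unfolding even_sextic_eq_iff by blast+
  then have "l^2*u = (l*a)^2 - 2*(l^2*b)" "l^4*v = (l^2*u)^2 - (l^2*b)^2 + 2*(l*a)*(l^3*c)"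
    "2*(l^2*u)*(l^4*v) - (l^2*u)^3 = -((l^3*c)^2)" by algebra+
  then show ?thesis unfolding even_sextic_eq_iff by blast
qed

lemma quad_of_uv_scale:
  "quad_of_uv (l^2*u) (l^4*v) = ((3*u^2*v - u^4 - v^2)*l^8, (2*u*v^2 - u^3*v)*l^10, l^2*u, l^4*v)"
proof -
  have "3*(l^2*u)^2*(l^4*v) - (l^2*u)^4 - (l^4*v)^2 = (3*u^2*v - u^4 - v^2)*l^8"
    "2*(l^2*u)*(l^4*v)^2 - (l^2*u)^3*(l^4*v) = (2*u*v^2 - u^3*v)*l^10" by algebra+
  then show ?thesis by (simp add: quad_of_uv_def)
qed

lemma type33_scale:
  assumes "quad_of_uv u v \<in> type33_quadruples" "l \<noteq> 0"
  shows "quad_of_uv (l^2*u) (l^4*v) \<in> type33_quadruples"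
proof -
  obtain a b c where irr: "irreducible (cubic a b c)" "even_sextic u v = cubic a b c * cubic (-a) b (-c)"
    and nz: "(3*u^2*v - u^4 - v^2) * (2*u*v^2 - u^3*v) \<noteq> 0"
    using assms(1) type33_quad_of_uv_iff by blast
  have "(3*u^2*v - u^4 - v^2)*l^8 * ((2*u*v^2 - u^3*v)*l^10) \<noteq> 0" using nz assms(2) by simp
  then have "(3*(l^2*u)^2*(l^4*v) - (l^2*u)^4 - (l^4*v)^2) * (2*(l^2*u)*(l^4*v)^2 - (l^2*u)^3*(l^4*v)) \<noteq> 0"
    using quad_of_uv_scale[of l u v] by (simp add: quad_of_uv_def)
  then show ?thesis
    using irreducible_cubic_scale[OF irr(1) assms(2)] even_sextic_scale[OF irr(2)] type33_quad_of_uv_iff by blast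
qed

lemma scaling_rel_quad_of_uv:
  "(quad_of_uv u v, quad_of_uv u' v') \<in> scaling_rel \<longleftrightarrow> (\<exists>l. l \<noteq> 0 \<and> u' = l^2*u \<and> v' = l^4*v)"
proof
  assume "\<exists>l. l \<noteq> 0 \<and> u' = l^2*u \<and> v' = l^4*v"
  then obtain l where "l \<noteq> 0" "u' = l^2*u" "v' = l^4*v" by blast
  then show "(quad_of_uv u v, quad_of_uv u' v') \<in> scaling_rel"
    using quad_of_uv_scale[of l u v] by (auto simp: scaling_rel_def quad_of_uv_def)
qed (auto simp: scaling_rel_def quad_of_uv_def)

lemma equiv_scaling_rel: "equiv UNIV scaling_rel"
proof (rule equivI)
  show "refl scaling_rel"
  proof (rule refl_onI)
    fix x :: quadruple
    show "(x, x) \<in> scaling_rel" by (cases x) (auto simp: scaling_rel_def intro!: exI[of _ 1])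
  qed
  show "sym scaling_rel"
  proof (rule symI)
    fix s t assume "(s, t) \<in> scaling_rel"
    then obtain A B u v l where "l \<noteq> 0" "s = (A, B, u, v)" "t = (A*l^8, B*l^10, l^2*u, l^4*v)"
      by (auto simp: scaling_rel_def)
    then show "(t, s) \<in> scaling_rel"
      by (auto simp: scaling_rel_def power_divide intro!: exI[of _ "1/l"])
  qed
  show "trans scaling_rel"
  proof (rule transI)
    fix r s t assume "(r, s) \<in> scaling_rel" "(s, t) \<in> scaling_rel"
    then obtain A B u v l m where "l \<noteq> 0" "m \<noteq> 0" "r = (A, B, u, v)"
      "t = (A*l^8*m^8, B*l^10*m^10, m^2*(l^2*u), m^4*(l^4*v))"
      by (auto simp: scaling_rel_def)
    then show "(r, t) \<in> scaling_rel"
      by (auto simp: scaling_rel_def power_mult_distrib intro!: exI[of _ "l*m"])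
  qed
qed simp

section \<open>Points of the curve and scaling classes\<close>

lemma param_eq: "param (X, Y) = quad_of_uv (2*X) (param_v X Y)"
  by (simp add: param_def)

lemma param_inj:
  assumes P: "P \<in> C_E" "param P \<in> type33_quadruples" and Q: "Q \<in> C_E"
    and rel: "(param P, param Q) \<in> scaling_rel"
  shows "P = Q"
proof -
  obtain X Y X' Y' where PQ: "P = (X, Y)" "Q = (X', Y')" by (metis surj_pair)
  obtain l where l: "l \<noteq> 0" "2*X' = l^2*(2*X)" "param_v X' Y' = l^4*param_v X Y"
    using rel unfolding PQ param_eq scaling_rel_quad_of_uv by blast
  define b c where "b = factor_quad X Y" and "c = factor_const X Y"
  have e: "even_sextic (2*X) (param_v X Y) = cubic X b c * cubic (-X) b (-c)"
    using param_factorization P(1) PQ b_def c_def by blast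
  have irr: "irreducible (cubic X b c)"
    using type33_factor_irreducible[OF _ e] P(2) unfolding PQ param_eq by blast
  have "cubic (l*X) (l^2*b) (l^3*c) * cubic (-(l*X)) (l^2*b) (-(l^3*c)) =
      cubic X' (factor_quad X' Y') (factor_const X' Y') * cubic (-X') (factor_quad X' Y') (- factor_const X' Y')"
    using even_sextic_scale[OF e, of l] param_factorization[of X' Y'] Q l PQ by simp
  from cubic_flip_unique[OF irreducible_cubic_scale[OF irr l(1)] this]
  have cases: "X' = l*X \<and> factor_const X' Y' = l^3*c \<or> X' = -(l*X) \<and> factor_const X' Y' = -(l^3*c)"
    by auto
  \<comment> \<open>\<open>X = 0\<close> would give \<open>u = 0\<close> and hence
    \<open>B = 0\<close>.\<close>
  have X0: "X \<noteq> 0"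
  proof
    assume "X = 0"
    then have "param P = quad_of_uv 0 (param_v X Y)" by (simp add: PQ param_eq)
    then show False using P(2) by (simp add: type33_quad_of_uv_iff)
  qed
  have X': "X' = l^2*X" using l(2) by simp
  \<comment> \<open>The first coefficient gives \<open>l*X\<close> up to sign, whereas
    \<open>u\<close> gives \<open>l^2*X\<close>; so \<open>l\<close> is 1 or -1, and the flip undoes
    the sign.\<close>
  have "X' = X \<and> factor_const X' Y' = c"
  proof -
    from cases have "l = 1 \<and> factor_const X' Y' = l^3*c \<or> l = -1 \<and> factor_const X' Y' = -(l^3*c)"
    proof
      assume h: "X' = l*X \<and> factor_const X' Y' = l^3*c"
      then have "l*(l-1)*X = 0" using X' by algebra
      then have "l = 1" using X0 l(1) by simp
      then show ?thesis using h by blast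
    next
      assume h: "X' = -(l*X) \<and> factor_const X' Y' = -(l^3*c)"
      then have "l*(l+1)*X = 0" using X' by algebra
      then have "l = -1" using X0 l(1) by (simp add: add_eq_0_iff2)
      then show ?thesis using h by blast
    qed
    then show ?thesis using X' by auto
  qed
  then show ?thesis using X0 PQ by (auto simp: c_def factor_const_def)
qed

lemma param_surj:
  assumes "t \<in> type33_quadruples"
  shows "\<exists>P\<in>C_E. param P \<in> type33_quadruples \<and> (t, param P) \<in> scaling_rel"
proof -
  obtain A B u v where t: "t = (A, B, u, v)" by (metis surj_pair)
  then have "quadratic_factor (A, B, u, v)" using assms type33_iff by blast
  then have t: "t = quad_of_uv u v" using t quadratic_factor_imp_quad_of_uv by blast
  obtain a b c where irr: "irreducible (cubic a b c)" "even_sextic u v = cubic a b c * cubic (-a) b (-c)"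
    and nz: "(3*u^2*v - u^4 - v^2) * (2*u*v^2 - u^3*v) \<noteq> 0"
    using assms type33_quad_of_uv_iff t by blast
  have eqs: "u = a^2-2*b" "v = u^2-b^2+2*a*c" "2*u*v-u^3 = -(c^2)"
    using irr(2) unfolding even_sextic_eq_iff by blast+
  have u: "u \<noteq> 0" using nz by auto
  have a: "a \<noteq> 0"
  proof
    assume "a = 0"
    then have c: "c^2 = 4*b^3" "u = -2*b" using eqs by algebra+
    then have b: "b \<noteq> 0" using u by auto
    \<comment> \<open>With \<open>a = 0\<close> the relations say \<open>b = m^2\<close> and
      \<open>c = -2 m^3\<close>, and \<open>m\<close> is a root of the cubic.\<close>
    define m where "m = -c/(2*b)"
    have "2*b*m = -c" using b by (simp add: m_def)
    then have "(2*b)^2*(m^2) = (2*b)^2*b" using c(1) by algebra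
    then have "m^2 = b" using b by simp
    then have "m^3 = b*m" by (simp add: power3_eq_cube power2_eq_square)
    then have "m^3 + b*m + c = 0" using \<open>2*b*m = -c\<close> by linarith
    then have "m^3 + a*m^2 + b*m + c = 0" using \<open>a = 0\<close> by simp
    then show False using irr(1) unfolding irreducible_cubic_iff by blast
  qed
  \<comment> \<open>The scaling that achieves \<open>l^2*u = 2*(l*a)\<close>, the normalization of
    \<open>param\<close>.\<close>
  define l where "l = 2*a/u"
  define X where "X = l*a"
  define Y where "Y = X^2*(c+2*a*u)/a^3"
  have l: "l \<noteq> 0" "l*u = 2*a" using a u by (simp_all add: l_def)
  have X0: "X \<noteq> 0" using a l by (simp add: X_def)
  have Y: "Y*a = l^2*(c+2*a*u)" using a by (simp add: Y_def X_def field_simps power2_eq_square power3_eq_cube)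
  have u': "2*X = l^2*u" using l(2) unfolding X_def by algebra
  have b': "factor_quad X Y = l^2*b"
  proof -
    have "2*X^2 - 4*X = 4*(l^2*b)" using eqs(1) l(2) unfolding X_def by algebra
    then show ?thesis by (simp add: factor_quad_def)
  qed
  have c': "factor_const X Y = l^3*c"
  proof -
    have "X*Y - 4*X^2 = l^3*c" using Y l(2) unfolding X_def by algebra
    then show ?thesis by (simp add: factor_const_def)
  qed
  have "param_v X Y = (l^2*u)^2 - (l^2*b)^2 + 2*X*(l^3*c)" unfolding param_v_def b' c' u' ..
  also have "\<dots> = l^4*v" unfolding eqs(2) X_def by algebra
  finally have v': "param_v X Y = l^4*v" .
  have "a^2*Y^2 = a^2*(X * (X^2 + 12*X - 4))"
  proof -
    \<comment> \<open>This is the result of eliminating \<open>b\<close> and \<open>v\<close> and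
      completing the square in \<open>c\<close>.\<close>
    have "2*((c+2*a*u)^2) = u*(a^4+6*a^2*u-u^2)" using eqs by algebra
    moreover have "a^2*Y^2 = (l^2*(c+2*a*u))^2" using Y by algebra
    ultimately have "2*(a^2*Y^2) = l^4*(u*(a^4+6*a^2*u-u^2))" by algebra
    also have "\<dots> = 2*(a^2*(X * (X^2 + 12*X - 4)))" using l(2) unfolding X_def by algebra
    finally show ?thesis by simp
  qed
  then have C: "(X, Y) \<in> C_E" using a by (simp add: C_E_def)
  have p: "param (X, Y) = quad_of_uv (l^2*u) (l^4*v)" unfolding param_eq u' v' ..
  have "param (X, Y) \<in> type33_quadruples" unfolding p using assms t l(1) by (auto intro: type33_scale)
  moreover have "(t, param (X, Y)) \<in> scaling_rel" unfolding p t scaling_rel_quad_of_uv using l(1) by blast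
  ultimately show ?thesis using C by blast
qed

lemma bij_param:
  "bij_betw (\<lambda>P. scaling_rel `` {param P}) {P\<in>C_E. param P \<in> type33_quadruples} (type33_quadruples // scaling_rel)"
  unfolding bij_betw_def
proof
  show "inj_on (\<lambda>P. scaling_rel `` {param P}) {P\<in>C_E. param P \<in> type33_quadruples}"
  proof (rule inj_onI)
    fix P Q assume P: "P \<in> {P\<in>C_E. param P \<in> type33_quadruples}" and Q: "Q \<in> {P\<in>C_E. param P \<in> type33_quadruples}"
      and "scaling_rel `` {param P} = scaling_rel `` {param Q}"
    then have "(param P, param Q) \<in> scaling_rel" using eq_equiv_class[OF _ equiv_scaling_rel] by blast
    then show "P = Q" using param_inj P Q by blast
  qed
  show "(\<lambda>P. scaling_rel `` {param P}) ` {P\<in>C_E. param P \<in> type33_quadruples} = type33_quadruples // scaling_rel"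
  proof (intro equalityI subsetI)
    fix c assume "c \<in> type33_quadruples // scaling_rel"
    then obtain t where t: "t \<in> type33_quadruples" "c = scaling_rel `` {t}" by (rule quotientE)
    then obtain P where P: "P \<in> C_E" "param P \<in> type33_quadruples" "(t, param P) \<in> scaling_rel" using param_surj by blast
    then have "c = scaling_rel `` {param P}" using t equiv_class_eq[OF equiv_scaling_rel] by blast
    then show "c \<in> (\<lambda>P. scaling_rel `` {param P}) ` {P\<in>C_E. param P \<in> type33_quadruples}" using P by blast
  qed (auto intro: quotientI)
qed

section \<open>Infinitely many points of type (3,3)\<close>

lemma param_type33:
  assumes "(X, Y) \<in> C_E" "cong3 X 1"
  shows "param (X, Y) \<in> type33_quadruples"
proof -
  have "cong3 (X * (X^2 + 12*X - 4)) (1 * (1^2 + 12*1 - 4))" by (intro cong3_intros assms)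
  then have "cong3 (Y^2) 9" using assms(1) by (simp add: C_E_def)
  then have "cong3 (Y^2) 0" by (rule cong3_cong) simp
  then have Y: "cong3 Y 0" by (rule cong3_square_0)
  define b c v where "b = factor_quad X Y" and "c = factor_const X Y" and "v = param_v X Y"
  have half: "cong3 (1/2) 2" unfolding cong3_def by (intro exI[of _ 1] exI[of _ 2]) simp
  have "cong3 (1/2 * X^2 - X) (2 * 1^2 - 1)" by (intro cong3_intros assms half)
  then have b: "cong3 b 1" by (simp add: b_def factor_quad_def)
  have "cong3 c (1 * 0 - 4 * 1^2)" unfolding c_def factor_const_def by (intro cong3_intros assms Y)
  then have c: "cong3 c 2" by (rule cong3_cong) simp
  have "cong3 v ((2*1)^2 - 1^2 + 2*1*2)" unfolding v_def param_v_def b_def[symmetric] c_def[symmetric]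
    by (intro cong3_intros assms b c)
  then have v: "cong3 v 1" by (rule cong3_cong) simp
  \<comment> \<open>\<open>A\<close> and \<open>B\<close> are nonzero because their residues modulo
    3, those of -5 and -4, are nonzero.\<close>
  have "cong3 (3*(2*X)^2*v - (2*X)^4 - v^2) (3*(2*1)^2*1 - (2*1)^4 - 1^2)" by (intro cong3_intros assms v)
  then have A: "3*(2*X)^2*v - (2*X)^4 - v^2 \<noteq> 0" by (rule cong3_nonzero) simp
  have "cong3 (2*(2*X)*v^2 - (2*X)^3*v) (2*(2*1)*1^2 - (2*1)^3*1)" by (intro cong3_intros assms v)
  then have B: "2*(2*X)*v^2 - (2*X)^3*v \<noteq> 0" by (rule cong3_nonzero) simp
  have "irreducible (cubic X b c)" unfolding irreducible_cubic_iff
    using cong3_no_root[OF assms(2) b c] by blast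
  moreover have "even_sextic (2*X) v = cubic X b c * cubic (-X) b (-c)"
    using param_factorization[OF assms(1)] by (simp only: b_def c_def v_def)
  ultimately show ?thesis unfolding param_eq type33_quad_of_uv_iff v_def[symmetric] using A B by auto
qed

text \<open>The multiple of (1,3) reduces to infinity modulo 3, so adding (1,3) brings the abscissa
  back to 1 modulo 3.\<close>

lemma orbit_point:
  "\<exists>X Y. P_E [^]\<^bsub>G_E\<^esub> (2^Suc k :: nat) \<uplus> P_E = Affine X Y \<and> (X, Y) \<in> C_E \<and> cong3 X 1"
proof -
  interpret comm_group G_E by (rule comm_group_E)
  obtain x y m n where k: "P_E [^]\<^bsub>G_E\<^esub> (2^Suc k :: nat) = Affine x y" "x \<noteq> 0" "\<not> 3 dvd n"
    "1/x = of_int (4^Suc k*(3*m)) / of_int n" using doubling_orbit by blast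
  have on: "on_E (Affine x y)" using nat_pow_closed[of P_E "2^Suc k"] k(1) by simp
  \<comment> \<open>With these two quantities, both congruent to 0, the abscissa of the sum becomes
    a fraction of 3-integral numbers with denominator congruent to 1.\<close>
  define w r where "w = 1/x" and "r = y/x^2"
  have w: "cong3 w 0" unfolding cong3_def w_def k(4) using k(3)
    by (intro exI[of _ "4^Suc k*(3*m)"] exI[of _ n]) simp
  have "y^2 = x^3 + 12*x^2 - 4*x" "w*x = 1" "r*x^2 = y" using on k(2) by (simp_all add: r_def w_def)
  then have "x^4 * r^2 = x^4 * (w + 12*w^2 - 4*w^3)" by algebra
  then have "r^2 = w + 12*w^2 - 4*w^3" using k(2) by simp
  moreover have "cong3 (w + 12*w^2 - 4*w^3) (0 + 12*0^2 - 4*0^3)" by (intro cong3_intros w)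
  ultimately have "cong3 (r^2) 0" by simp
  then have r: "cong3 r 0" by (rule cong3_square_0)
  have "cong3 ((1-w)^2) ((1-0)^2)" by (intro cong3_intros w)
  then have "cong3 ((1-w)^2) 1" by simp
  then have iw: "cong3 (1 / (1-w)^2) 1" by (rule cong3_inverse)
  have "cong3 ((1 + 21*w - 4*w^2 - 6*r) * (1 / (1-w)^2)) ((1 + 21*0 - 4*0^2 - 6*0) * 1)"
    by (intro cong3_intros w r iw)
  then have c: "cong3 ((1 + 21*w - 4*w^2 - 6*r) / (1-w)^2) 1" by simp
  have x1: "x \<noteq> 1"
  proof
    assume "x = 1"
    then have "cong3 0 1" using cong3_diff[OF cong3_1 w] by (simp add: w_def)
    then show False using cong3_0_dvd[of 1] by simp
  qed
  have "(x^2+21*x-4-6*y)/(x-1)^2 = (1 + 21*w - 4*w^2 - 6*r) / (1-w)^2"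
  proof -
    have "x^2+21*x-4-6*y = x^2*(1 + 21*w - 4*w^2 - 6*r)" "(x-1)^2 = x^2*(1-w)^2"
      using k(2) by (simp_all add: r_def w_def field_simps power2_eq_square)
    then show ?thesis using k(2) by simp
  qed
  then obtain Y where XY: "Affine x y \<uplus> P_E = Affine ((1 + 21*w - 4*w^2 - 6*r) / (1-w)^2) Y"
    using add_P[OF on x1] by auto
  define X where "X = (1 + 21*w - 4*w^2 - 6*r) / (1-w)^2"
  have "on_E (Affine X Y)" using on_E_add[OF on on_E_TP(2)] XY X_def by simp
  then have "(X, Y) \<in> C_E" by (simp add: C_E_def algebra_simps power2_eq_square power3_eq_cube)
  then show ?thesis using XY c k(1) X_def by metis
qed

lemma infinite_type33_points: "infinite {P\<in>C_E. param P \<in> type33_quadruples}"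
proof -
  interpret comm_group G_E by (rule comm_group_E)
  obtain X Y where XY: "\<And>k. P_E [^]\<^bsub>G_E\<^esub> (2^Suc k :: nat) \<uplus> P_E = Affine (X k) (Y k)"
    "\<And>k. (X k, Y k) \<in> C_E" "\<And>k. cong3 (X k) 1"
    using orbit_point by metis
  have "inj (\<lambda>k. (X k, Y k))"
  proof (rule injI)
    fix k l assume "(X k, Y k) = (X l, Y l)"
    then have "P_E [^]\<^bsub>G_E\<^esub> (2^Suc k :: nat) \<otimes>\<^bsub>G_E\<^esub> P_E = P_E [^]\<^bsub>G_E\<^esub> (2^Suc l :: nat) \<otimes>\<^bsub>G_E\<^esub> P_E"
      using XY(1) by simp
    moreover have "P_E \<in> carrier G_E" by simp
    ultimately have "P_E [^]\<^bsub>G_E\<^esub> (2^Suc k :: nat) = P_E [^]\<^bsub>G_E\<^esub> (2^Suc l :: nat)"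
      using right_cancel nat_pow_closed by metis
    then show "k = l" using doubling_orbit_inj by (rule injD[rotated])
  qed
  then have "infinite (range (\<lambda>k. (X k, Y k)))" by (rule range_inj_infinite)
  moreover have "range (\<lambda>k. (X k, Y k)) \<subseteq> {P\<in>C_E. param P \<in> type33_quadruples}"
    using XY param_type33 by auto
  ultimately show ?thesis using finite_subset by blast
qed

section \<open>The parametrization as four polynomials\<close>

lemma eval2_ring:
  "eval2 (F + G) X Y = eval2 F X Y + eval2 G X Y"
  "eval2 (F - G) X Y = eval2 F X Y - eval2 G X Y"
  "eval2 (F * G) X Y = eval2 F X Y * eval2 G X Y"
  "eval2 (F ^ n) X Y = eval2 F X Y ^ n"
  by (simp_all add: eval2_def)

lemma param_polynomial:
  "\<exists>FA FB FU FV :: rat poly poly. \<forall>X Y. param (X, Y) = (eval2 FA X Y, eval2 FB X Y, eval2 FU X Y, eval2 FV X Y)"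
proof -
  define k :: "rat \<Rightarrow> rat poly poly" where "k = (\<lambda>c. [:[:c:]:])"
  define x y :: "rat poly poly" where "x = [:[:0, 1:]:]" and "y = [:0, 1:]"
  define U where "U = k 2 * x"
  define V where "V = U^2 - (k (1/2) * x^2 - x)^2 + k 2 * x * (x*y - k 4 * x^2)"
  define A where "A = k 3 * U^2 * V - U^4 - V^2"
  define B where "B = k 2 * U * V^2 - U^3 * V"
  have "eval2 (k c) X Y = c" "eval2 x X Y = X" "eval2 y X Y = Y" for c X Y
    by (simp_all add: eval2_def k_def x_def y_def)
  then have "param (X, Y) = (eval2 A X Y, eval2 B X Y, eval2 U X Y, eval2 V X Y)" for X Y
    by (simp add: A_def B_def V_def U_def eval2_ring param_eq quad_of_uv_def
        param_v_def factor_quad_def factor_const_def)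
  then show ?thesis by blast
qed

theorem theorem6p2:
  shows "(\<exists>S \<subseteq> type33_quadruples. infinite S \<and>
            (\<forall>s\<in>S. \<forall>t\<in>S. s \<noteq> t \<longrightarrow> (s, t) \<notin> scaling_rel)) \<and>
    (\<exists>FA FB FU FV :: rat poly poly.
       let C = {(X, Y). Y ^ 2 = X * (X ^ 2 + 12 * X - 4)};
           \<Phi> = (\<lambda>(X, Y). (eval2 FA X Y, eval2 FB X Y, eval2 FU X Y, eval2 FV X Y))
       in (\<forall>P\<in>C. quadratic_factor (\<Phi> P) \<and>
             (\<exists>g h. degree g = 3 \<and> degree h = 3 \<and> sextic (\<Phi> P) = g * h)) \<and>
          infinite {P\<in>C. \<Phi> P \<in> type33_quadruples} \<and>
          bij_betw (\<lambda>P. scaling_rel `` {\<Phi> P})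
            {P\<in>C. \<Phi> P \<in> type33_quadruples} (type33_quadruples // scaling_rel)) \<and>
    is_elliptic_curve 12 (-4) 0 \<and>
    group_rank (ec_group 12 (-4) 0) = 1"
proof (intro conjI)
  \<comment> \<open>The image of \<open>R\<close> under \<open>param\<close> is the required set,
    since \<open>param_inj\<close> separates its scaling classes.\<close>
  define R where "R = {P\<in>C_E. param P \<in> type33_quadruples}"
  have inj: "P = Q" if "P \<in> R" "Q \<in> R" "(param P, param Q) \<in> scaling_rel" for P Q
    using param_inj that by (simp add: R_def)
  have refl: "(s, s) \<in> scaling_rel" for s using equiv_class_self[OF equiv_scaling_rel, of s] by simp
  have "inj_on param R"
  proof (rule inj_onI)
    fix P Q assume "P \<in> R" "Q \<in> R" "param P = param Q"
    then show "P = Q" using inj refl by metis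
  qed
  then have "infinite (param ` R)" using infinite_type33_points finite_imageD unfolding R_def by blast
  moreover have "param ` R \<subseteq> type33_quadruples" by (auto simp: R_def)
  moreover have "\<forall>s\<in>param ` R. \<forall>t\<in>param ` R. s \<noteq> t \<longrightarrow> (s, t) \<notin> scaling_rel" using inj by blast
  ultimately show "\<exists>S \<subseteq> type33_quadruples. infinite S \<and> (\<forall>s\<in>S. \<forall>t\<in>S. s \<noteq> t \<longrightarrow> (s, t) \<notin> scaling_rel)"
    by blast
next
  obtain FA FB FU FV :: "rat poly poly"
    where F: "\<And>X Y. param (X, Y) = (eval2 FA X Y, eval2 FB X Y, eval2 FU X Y, eval2 FV X Y)"
    using param_polynomial by blast
  have param: "(\<lambda>(X, Y). (eval2 FA X Y, eval2 FB X Y, eval2 FU X Y, eval2 FV X Y)) = param"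
    using F by auto
  have "quadratic_factor (param P) \<and> (\<exists>g h. degree g = 3 \<and> degree h = 3 \<and> sextic (param P) = g * h)"
    if "P \<in> C_E" for P
  proof -
    obtain X Y where P: "P = (X, Y)" by fastforce
    have e: "even_sextic (2*X) (param_v X Y) =
        cubic X (factor_quad X Y) (factor_const X Y) * cubic (-X) (factor_quad X Y) (- factor_const X Y)"
      using param_factorization that P by blast
    show ?thesis unfolding P param_eq sextic_quad_of_uv
    proof (intro conjI exI)
      show "degree (cubic X (factor_quad X Y) (factor_const X Y)) = 3" by simp
      show "degree (cubic (-X) (factor_quad X Y) (- factor_const X Y)) = 3" by simp
    qed (rule quadratic_factor_quad_of_uv e)+
  qed
  then show "\<exists>FA FB FU FV :: rat poly poly.
       let C = {(X, Y). Y ^ 2 = X * (X ^ 2 + 12 * X - 4)};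
           \<Phi> = (\<lambda>(X, Y). (eval2 FA X Y, eval2 FB X Y, eval2 FU X Y, eval2 FV X Y))
       in (\<forall>P\<in>C. quadratic_factor (\<Phi> P) \<and>
             (\<exists>g h. degree g = 3 \<and> degree h = 3 \<and> sextic (\<Phi> P) = g * h)) \<and>
          infinite {P\<in>C. \<Phi> P \<in> type33_quadruples} \<and>
          bij_betw (\<lambda>P. scaling_rel `` {\<Phi> P})
            {P\<in>C. \<Phi> P \<in> type33_quadruples} (type33_quadruples // scaling_rel)"
    unfolding Let_def C_E_def[symmetric]
    by (intro exI[of _ FA] exI[of _ FB] exI[of _ FU] exI[of _ FV])
       (unfold param, use infinite_type33_points bij_param in blast)
next
  show "is_elliptic_curve 12 (-4) 0" by (simp add: is_elliptic_curve_def)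
  show "group_rank (ec_group 12 (-4) 0) = 1" by (rule rank_E)
qed

end
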